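(* Let $d \ge 3$ be an integer and let $G$ be a diameter graph in $\mathbb{R}^d$. Then two $d$-cliques in $G$ cannot share exactly $d-3$ vertices. In particular, if any two $d$-cliques in $G$ share at least $d-3$ vertices, then the number of $d$-cliques in $G$ is at most the number of vertices of $G$.
   Context: A diameter graph in $\mathbb{R}^d$ is a graph whose vertex set is a finite subset $X$ of $\mathbb{R}^d$ and whose edges are exactly the pairs of points of $X$ whose Euclidean distance equals the diameter of $X$ (one may normalise the diameter to be $1$). A $d$-clique is a set of $d$ pairwise adjacent vertices. *)

theory Defs
  imports "HOL-Analysis.Analysis" "HOL-Library.Ramsey"
begin

text \<open>
  Graphs are given by a vertex set \<open>V\<close> and a set \<open>E\<close> of two-element subsets of \<open>V\<close>, the
  representation used by \<^const>\<open>clique\<close>. The condition \<open>x \<noteq> y\<close> matters only when \<open>V\<close> is a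
  singleton, where the diameter is \<open>0\<close>. The diameter is not normalised.
\<close>

definition diameter_graph :: "'a::metric_space set \<Rightarrow> 'a set set \<Rightarrow> bool" where
  "diameter_graph V E \<longleftrightarrow>
     finite V \<and>
     E = {{x, y} | x y. x \<in> V \<and> y \<in> V \<and> x \<noteq> y \<and> dist x y = diameter V}"

definition cliques_of_size :: "nat \<Rightarrow> 'a set \<Rightarrow> 'a set set \<Rightarrow> 'a set set" where
  "cliques_of_size k V E = {K. K \<subseteq> V \<and> finite K \<and> card K = k \<and> clique K E}"

end

theory Submission
  imports Defs
begin

text \<open>
  Rescale so that the diameter is 1. A \<open>d\<close>-clique is then a regular simplex of unit edge length
  with \<open>d\<close> vertices, and all points of the configuration have mutual distance at most 1.

  \<^bold>\<open>No two \<open>d\<close>-cliques share exactly \<open>d - 3\<close> vertices.\<close> Two such cliques leave two disjoint unit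
  triangles \<open>A\<close> and \<open>B\<close>. If \<open>d = 3\<close>, they lie in a 3-dimensional space. Otherwise the common
  vertices form a simplex to which all six points are equidistant, so after moving its centroid to
  the origin the six points lie in a 4-dimensional subspace, on a sphere of squared radius
  \<open>c + 1/2\<close> with \<open>0 < c \<le> 1/2\<close>. Dimension counting gives linear relations
  \<open>V = (\<Sum>a\<in>A. u a *\<^sub>R a) = - (\<Sum>b\<in>B. u b *\<^sub>R b)\<close> whose coefficient sums over \<open>A\<close> and \<open>B\<close> can be
  prescribed to be zero, both in the first case and one of them in the second.

  Up to a sign, weights of both signs on three points have exactly one negative weight. If \<open>u\<close> has
  exactly one negative weight on \<open>A\<close>, at \<open>x\<close>, then a comparison of weighted sums of squared distances
  shows \<open>V \<bullet> (y - x) > 0\<close> for every other \<open>y\<close> at distance at most 1 from \<open>A\<close>. If moreover \<open>- u\<close> has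
  exactly one negative weight on \<open>B\<close>, at \<open>y\<close>, the roles of \<open>x\<close> and \<open>y\<close> may be exchanged, which is a
  contradiction (\<open>same_sign_impossible\<close>). So it is \<open>u\<close> itself that has one negative weight on \<open>B\<close>, at
  \<open>y\<close>. Then the sum of all squared distances between \<open>A\<close> and \<open>B\<close> with the weights \<open>u a * u b\<close> leads to
  a quadratic inequality, which for coefficient sums of equal sign fails unless \<open>norm V\<close> lies strictly
  between \<open>- u x\<close> and \<open>- u y\<close> (\<open>opposite_sign_impossible\<close>). With both coefficient sums zero,
  \<open>norm V\<close> is at most both of these numbers, and this settles the flat case. On the sphere, the
  relations whose sum over \<open>A\<close> vanishes and those whose sum over \<open>B\<close> vanishes place \<open>norm V\<close> between
  the two numbers in opposite orders, and between them the intermediate value theorem provides a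
  relation for which the two numbers agree (\<open>spherical_triangles_impossible\<close>).

  \<^bold>\<open>Counting.\<close> By the first part, any two cliques share at least \<open>d - 2\<close> vertices. Over a fixed
  \<open>d\<close>-clique there is at most one apex (\<open>apex_unique\<close>). If some \<open>d + 1\<close> points are pairwise
  adjacent, every clique that is not among their subsets has one further point, and no two cliques
  have the same one. If no such points exist and the cliques have no \<open>d - 2\<close> vertices in common,
  there is a central clique which every clique meets in at least \<open>d - 1\<close> vertices, and again each
  other clique has a point of its own. If all cliques contain the same \<open>d - 2\<close> vertices, the remaining
  pairs form a graph, and it suffices to see that it has at most as many edges as vertices. This
  is the Hopf-Pannwitz argument: among three neighbours of a vertex, the middle one has no other
  neighbour (\<open>middle_point_has_one_neighbour\<close>).
\<close>

section \<open>Weighted sums of squared distances\<close>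

definition unit_simplex :: "'a::metric_space set \<Rightarrow> bool" where
  "unit_simplex K \<longleftrightarrow> finite K \<and> pairwise (\<lambda>p q. dist p q = 1) K"

lemma unit_simplex_finite: "unit_simplex K \<Longrightarrow> finite K"
  by (simp add: unit_simplex_def)

lemma unit_simplex_dist: "\<lbrakk>unit_simplex K; p \<in> K; q \<in> K; p \<noteq> q\<rbrakk> \<Longrightarrow> dist p q = 1"
  by (simp add: unit_simplex_def pairwise_def)

lemma unit_simplex_subset: "\<lbrakk>unit_simplex K; L \<subseteq> K\<rbrakk> \<Longrightarrow> unit_simplex L"
  by (meson finite_subset pairwise_subset unit_simplex_def)

lemma dist_square_inner:
  fixes x y :: "'a::real_inner"
  shows "(dist x y)\<^sup>2 = x \<bullet> x + y \<bullet> y - 2 * (x \<bullet> y)"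
  by (simp add: dist_norm power2_norm_eq_inner inner_diff inner_commute)

lemma weighted_sum_dist_square:
  fixes A :: "'a::real_inner set"
  shows "(\<Sum>a\<in>A. u a * (dist a z)\<^sup>2)
    = (\<Sum>a\<in>A. u a * (a \<bullet> a)) + sum u A * (z \<bullet> z) - 2 * ((\<Sum>a\<in>A. u a *\<^sub>R a) \<bullet> z)"
  unfolding dist_square_inner
  by (simp add: algebra_simps sum.distrib sum_subtractf sum_distrib_left sum_distrib_right
      inner_sum_left sum_negf)

lemma double_weighted_sum_dist_square:
  fixes A B :: "'a::real_inner set"
  shows "(\<Sum>b\<in>B. w b * (\<Sum>a\<in>A. u a * (dist a b)\<^sup>2))
    = sum w B * (\<Sum>a\<in>A. u a * (a \<bullet> a)) + sum u A * (\<Sum>b\<in>B. w b * (b \<bullet> b))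
      - 2 * ((\<Sum>a\<in>A. u a *\<^sub>R a) \<bullet> (\<Sum>b\<in>B. w b *\<^sub>R b))"
proof -
  define V where "V = (\<Sum>a\<in>A. u a *\<^sub>R a)"
  have "(\<Sum>b\<in>B. w b * (\<Sum>a\<in>A. u a * (dist a b)\<^sup>2))
      = (\<Sum>b\<in>B. w b * (\<Sum>a\<in>A. u a * (a \<bullet> a)) + sum u A * (w b * (b \<bullet> b)) - 2 * (V \<bullet> (w b *\<^sub>R b)))"
    unfolding weighted_sum_dist_square V_def by (intro sum.cong) (simp_all add: algebra_simps)
  then show ?thesis
    by (simp add: V_def sum.distrib sum_subtractf inner_sum_right
        flip: sum_distrib_left sum_distrib_right)
qed

lemma unit_simplex_weighted_sum_dist_square:
  assumes "unit_simplex A" "x \<in> A"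
  shows "(\<Sum>a\<in>A. u a * (dist a x)\<^sup>2) = sum u A - u x"
proof -
  have "(\<Sum>a\<in>A. u a * (dist a x)\<^sup>2) = (\<Sum>a\<in>A. u a - (if a = x then u a else 0))"
    using unit_simplex_dist[OF assms(1) _ assms(2)] by (intro sum.cong) auto
  then show ?thesis
    using assms(2) unit_simplex_finite[OF assms(1)] by (simp add: sum_subtractf)
qed

text \<open>
  The double sum of squared distances, weighted by \<open>u p * u q\<close>, can be computed in two ways: the
  distances are 0 or 1, and they expand into inner products. The squared norms of the points
  disappear from the expansion if the weights have sum zero or if these norms are all equal.
\<close>

lemma unit_simplex_norm_combination:
  fixes A :: "'a::real_inner set"
  assumes A: "unit_simplex A"
    and "sum u A = 0 \<or> (\<forall>a\<in>A. (norm a)\<^sup>2 = c + 1/2)"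
  shows "(norm (\<Sum>a\<in>A. u a *\<^sub>R a))\<^sup>2 = c * (sum u A)\<^sup>2 + (\<Sum>a\<in>A. (u a)\<^sup>2) / 2"
proof -
  have "(\<Sum>b\<in>A. u b * (\<Sum>a\<in>A. u a * (dist a b)\<^sup>2)) = (\<Sum>b\<in>A. u b * sum u A - (u b)\<^sup>2)"
    by (intro sum.cong refl) (simp only: unit_simplex_weighted_sum_dist_square[OF A]
        right_diff_distrib power2_eq_square[of "u _"])
  also have "\<dots> = (sum u A)\<^sup>2 - (\<Sum>a\<in>A. (u a)\<^sup>2)"
    by (simp add: sum_subtractf power2_eq_square sum_distrib_right)
  finally have *: "(sum u A)\<^sup>2 - (\<Sum>a\<in>A. (u a)\<^sup>2)
      = 2 * (sum u A * (\<Sum>a\<in>A. u a * (a \<bullet> a))) - 2 * (norm (\<Sum>a\<in>A. u a *\<^sub>R a))\<^sup>2"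
    unfolding double_weighted_sum_dist_square by (simp add: power2_norm_eq_inner)
  have "sum u A * (\<Sum>a\<in>A. u a * (a \<bullet> a)) = sum u A * (sum u A * (c + 1/2))"
    using assms(2)
  proof
    assume "\<forall>a\<in>A. (norm a)\<^sup>2 = c + 1/2"
    then have "(\<Sum>a\<in>A. u a * (a \<bullet> a)) = sum u A * (c + 1/2)"
      by (simp add: power2_norm_eq_inner sum_distrib_right)
    then show ?thesis by simp
  qed simp
  with * show ?thesis
    by (simp add: algebra_simps power2_eq_square)
qed

section \<open>Linear relations between two unit simplices\<close>

text \<open>
  For a combination of points of \<open>A\<close> with such weights of sum zero, this says that it is a direction
  from \<open>x\<close> into the cone spanned by the other points of \<open>A\<close>.
\<close>

definition one_negative :: "'a set \<Rightarrow> ('a \<Rightarrow> real) \<Rightarrow> 'a \<Rightarrow> bool" where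
  "one_negative A u x \<longleftrightarrow> x \<in> A \<and> u x < 0 \<and> (\<forall>a\<in>A - {x}. 0 \<le> u a)"

text \<open>
  Compare the weighted sums of the squared distances to \<open>x\<close> and to \<open>y\<close>. At \<open>x\<close> all relevant
  distances are 1, at \<open>y\<close> those with nonnegative weight are at most 1, and the only negative weight
  multiplies the squared distance of \<open>x\<close> and \<open>y\<close>. On the other hand the difference of the two sums
  is linear in \<open>y - x\<close>.
\<close>

lemma one_negative_direction:
  fixes A :: "'a::real_inner set"
  assumes A: "unit_simplex A" and u: "one_negative A u x"
    and near: "\<And>a. a \<in> A \<Longrightarrow> dist a y \<le> 1"
    and level: "sum u A = 0 \<or> norm x = norm y"
  shows "- u x * (dist x y)\<^sup>2 \<le> 2 * ((\<Sum>a\<in>A. u a *\<^sub>R a) \<bullet> (y - x))"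
    and "(\<Sum>a\<in>A. u a * (dist a y)\<^sup>2) = sum u A - u x - 2 * ((\<Sum>a\<in>A. u a *\<^sub>R a) \<bullet> (y - x))"
proof -
  have x: "x \<in> A" and fin: "finite A"
    using u A by (auto simp: one_negative_def unit_simplex_finite)
  have same: "sum u A * (x \<bullet> x) = sum u A * (y \<bullet> y)"
    using level by (auto simp flip: power2_norm_eq_inner)
  then show eq: "(\<Sum>a\<in>A. u a * (dist a y)\<^sup>2)
      = sum u A - u x - 2 * ((\<Sum>a\<in>A. u a *\<^sub>R a) \<bullet> (y - x))"
    using unit_simplex_weighted_sum_dist_square[OF A x, of u] same
    unfolding weighted_sum_dist_square inner_diff_right right_diff_distrib by linarith
  have "(\<Sum>a\<in>A. u a * (dist a y)\<^sup>2)
      = u x * (dist x y)\<^sup>2 + (\<Sum>a\<in>A - {x}. u a * (dist a y)\<^sup>2)"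
    using x fin by (simp add: sum.remove)
  also have "(\<Sum>a\<in>A - {x}. u a * (dist a y)\<^sup>2) \<le> (\<Sum>a\<in>A - {x}. u a)"
    using u near by (intro sum_mono mult_left_le) (auto simp: one_negative_def power_le_one)
  also have "\<dots> = sum u A - u x"
    using x fin by (simp add: sum_diff1)
  finally show "- u x * (dist x y)\<^sup>2 \<le> 2 * ((\<Sum>a\<in>A. u a *\<^sub>R a) \<bullet> (y - x))"
    using eq by simp
qed

text \<open>
  The two situations in which squared norms cancel from weighted sums of squared distances: the
  weights have sum zero on each simplex, or all points lie on one sphere about the origin.
\<close>

definition common_level :: "'a::real_inner set \<Rightarrow> 'a set \<Rightarrow> real \<Rightarrow> ('a \<Rightarrow> real) \<Rightarrow> bool" where
  "common_level A B c u \<longleftrightarrow>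
     sum u A = 0 \<and> sum u B = 0 \<or> 0 < c \<and> (\<forall>z\<in>A \<union> B. (norm z)\<^sup>2 = c + 1/2)"

lemma common_level_norm_eq:
  assumes "common_level A B c u" "x \<in> A \<union> B" "y \<in> A \<union> B"
  shows "sum u A = 0 \<and> sum u B = 0 \<or> norm x = norm y"
  using assms unfolding common_level_def by (metis norm_ge_zero power2_eq_iff_nonneg)

lemma common_level_commute: "common_level A B c u \<longleftrightarrow> common_level B A c u"
  by (auto simp: common_level_def)

lemma common_level_minus: "common_level A B c (\<lambda>z. - u z) \<longleftrightarrow> common_level A B c u"
  by (simp add: common_level_def sum_negf)

locale disjoint_simplices =
  fixes A B :: "'a::real_inner set"
  assumes A: "unit_simplex A" and B: "unit_simplex B" and disjoint: "A \<inter> B = {}"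
    and near: "\<And>a b. \<lbrakk>a \<in> A; b \<in> B\<rbrakk> \<Longrightarrow> dist a b \<le> 1"
begin

lemma swap: "disjoint_simplices B A"
  using A B disjoint near by unfold_locales (auto, metis dist_commute)

lemma fin: "finite A" "finite B"
  using A B unit_simplex_finite by auto

text \<open>
  By \<open>one_negative_direction\<close>, the combination over \<open>A\<close> has positive inner product with \<open>y - x\<close>.
  It equals the combination over \<open>B\<close> with the weights \<open>- u\<close>, and so by the same lemma, with the
  roles exchanged, it has positive inner product with \<open>x - y\<close>.
\<close>

lemma same_sign_impossible:
  assumes rel: "(\<Sum>b\<in>B. u b *\<^sub>R b) = - (\<Sum>a\<in>A. u a *\<^sub>R a)" and level: "common_level A B c u"
    and x: "one_negative A u x" and y: "one_negative B (\<lambda>z. - u z) y"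
  shows False
proof -
  have xy: "x \<in> A" "y \<in> B" "x \<noteq> y" "u x < 0" "u y > 0"
    using x y disjoint by (auto simp: one_negative_def)
  have "- u x * (dist x y)\<^sup>2 \<le> 2 * ((\<Sum>a\<in>A. u a *\<^sub>R a) \<bullet> (y - x))"
    using common_level_norm_eq[OF level, of x y] xy near
    by (intro one_negative_direction[OF A x]) auto
  moreover have "u y * (dist y x)\<^sup>2 \<le> 2 * ((\<Sum>b\<in>B. - u b *\<^sub>R b) \<bullet> (x - y))"
    using common_level_norm_eq[OF level, of x y] xy near one_negative_direction(1)[OF B y, of x]
    by (force simp: dist_commute sum_negf)
  moreover have "(\<Sum>b\<in>B. - u b *\<^sub>R b) \<bullet> (x - y) = - ((\<Sum>a\<in>A. u a *\<^sub>R a) \<bullet> (y - x))"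
    using rel by (simp add: sum_negf inner_diff_right)
  moreover have "- u x * (dist x y)\<^sup>2 > 0" "u y * (dist y x)\<^sup>2 > 0"
    using xy by (auto intro!: mult_pos_pos simp: mult_neg_pos)
  ultimately show False by linarith
qed

text \<open>
  The sum of \<open>u a * u b * (dist a b)\<^sup>2\<close> over \<open>A\<close> and \<open>B\<close> equals, up to a multiple of the product of
  the coefficient sums, twice the squared norm of \<open>V\<close>. It is bounded from above term by term: the
  terms with two nonnegative weights use that the distances are at most 1, and the sums of the terms
  at \<open>x\<close> and of those at \<open>y\<close> are known exactly by \<open>one_negative_direction\<close>.
\<close>

lemma opposite_sign_inequality:
  assumes rel: "(\<Sum>b\<in>B. u b *\<^sub>R b) = - (\<Sum>a\<in>A. u a *\<^sub>R a)" and level: "common_level A B c u"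
    and x: "one_negative A u x" and y: "one_negative B u y"
  defines "V \<equiv> \<Sum>a\<in>A. u a *\<^sub>R a"
  shows "(norm V)\<^sup>2 + u x * u y * (1 + (dist x y)\<^sup>2) / 2 + c * (sum u A * sum u B)
    \<le> - (u x + u y) * (V \<bullet> (y - x))"
proof -
  have xy: "x \<in> A" "y \<in> B" "u x < 0" "u y < 0" "\<And>b. b \<in> B - {y} \<Longrightarrow> 0 \<le> u b"
    using x y by (auto simp: one_negative_def)
  define G where "G b = (\<Sum>a\<in>A. u a * (dist a b)\<^sup>2)" for b
  have Gy: "G y = sum u A - u x - 2 * (V \<bullet> (y - x))"
    unfolding G_def V_def
    using common_level_norm_eq[OF level, of x y] xy near
    by (intro one_negative_direction[OF A x]) auto
  have G_other: "G b \<le> sum u A - u x + u x * (dist b x)\<^sup>2" if "b \<in> B" for b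
    using one_negative_direction[OF A x, of b] common_level_norm_eq[OF level, of x b] xy near that
    by (auto simp: G_def dist_commute)
  have Hx: "(\<Sum>b\<in>B. u b * (dist b x)\<^sup>2) = sum u B - u y - 2 * (V \<bullet> (y - x))"
    using one_negative_direction(2)[OF B y, of x] common_level_norm_eq[OF level, of x y] xy near rel
    by (force simp: dist_commute V_def inner_diff_right)
  have "(\<Sum>b\<in>B. u b * G b) = u y * G y + (\<Sum>b\<in>B - {y}. u b * G b)"
    using xy fin by (simp add: sum.remove)
  also have "(\<Sum>b\<in>B - {y}. u b * G b)
      \<le> (\<Sum>b\<in>B - {y}. u b * (sum u A - u x + u x * (dist b x)\<^sup>2))"
    using G_other xy(5) by (intro sum_mono mult_left_mono) auto
  also have "\<dots> = (\<Sum>b\<in>B. u b * (sum u A - u x + u x * (dist b x)\<^sup>2))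
      - u y * (sum u A - u x + u x * (dist y x)\<^sup>2)"
    using xy fin by (simp add: sum_diff1)
  also have "(\<Sum>b\<in>B. u b * (sum u A - u x + u x * (dist b x)\<^sup>2))
      = sum u B * (sum u A - u x) + u x * (\<Sum>b\<in>B. u b * (dist b x)\<^sup>2)"
    by (simp add: sum.distrib sum_distrib_left sum_distrib_right algebra_simps sum_subtractf)
  finally have S: "(\<Sum>b\<in>B. u b * G b) \<le> u y * (sum u A - u x - 2 * (V \<bullet> (y - x)))
      + sum u B * (sum u A - u x) + u x * (sum u B - u y - 2 * (V \<bullet> (y - x)))
      - u y * (sum u A - u x + u x * (dist y x)\<^sup>2)"
    unfolding Gy Hx by simp
  have S': "(\<Sum>b\<in>B. u b * G b) = sum u B * (\<Sum>a\<in>A. u a * (a \<bullet> a))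
      + sum u A * (\<Sum>b\<in>B. u b * (b \<bullet> b)) + 2 * (norm V)\<^sup>2"
    unfolding G_def double_weighted_sum_dist_square using rel
    by (simp add: V_def power2_norm_eq_inner)
  have "sum u B * (\<Sum>a\<in>A. u a * (a \<bullet> a)) + sum u A * (\<Sum>b\<in>B. u b * (b \<bullet> b))
      = (2 * c + 1) * (sum u A * sum u B)"
    using level unfolding common_level_def
  proof
    assume "0 < c \<and> (\<forall>z\<in>A \<union> B. (norm z)\<^sup>2 = c + 1/2)"
    then have "(\<Sum>a\<in>A. u a * (a \<bullet> a)) = sum u A * (c + 1/2)"
      "(\<Sum>b\<in>B. u b * (b \<bullet> b)) = sum u B * (c + 1/2)"
      by (simp_all add: power2_norm_eq_inner sum_distrib_right)
    then show ?thesis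
      by (simp add: algebra_simps)
  qed simp
  moreover define P where "P = V \<bullet> (y - x)"
  ultimately show ?thesis
    using S S' unfolding P_def[symmetric] dist_commute[of y x] by (simp add: field_simps)
qed

text \<open>
  This is the equality case of the quadratic inequality used in the next lemma. On the sphere, the
  inner product of \<open>x\<close> with the combination shows that the weights have sum zero. The weighted sum
  of the squared distances to \<open>y\<close> then equals its term at \<open>x\<close>. So every other point of nonzero weight
  would coincide with \<open>y\<close>, and there is such a point because the weights have sum zero.
\<close>

lemma rigid_position_impossible:
  assumes level: "common_level A B c u" and x: "one_negative A u x" and y: "y \<in> B"
    and dist: "dist x y = 1" and V: "(\<Sum>a\<in>A. u a *\<^sub>R a) = - u x *\<^sub>R (y - x)"
  shows False
proof -
  have x': "x \<in> A" "u x < 0" "\<And>a. a \<in> A - {x} \<Longrightarrow> 0 \<le> u a"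
    using x by (auto simp: one_negative_def)
  have unit: "(y - x) \<bullet> (y - x) = 1"
    using dist by (simp add: dist_norm norm_minus_commute[of x y] flip: power2_norm_eq_inner)
  have "sum u A = 0"
    using level unfolding common_level_def
  proof
    assume sphere: "0 < c \<and> (\<forall>z\<in>A \<union> B. (norm z)\<^sup>2 = c + 1/2)"
    then have n: "x \<bullet> x = c + 1/2" "y \<bullet> y = c + 1/2" "\<forall>a\<in>A. a \<bullet> a = c + 1/2"
      using x' y by (auto simp: power2_norm_eq_inner)
    have "(\<Sum>a\<in>A. u a * (a \<bullet> a)) = sum u A * (c + 1/2)"
      using n(3) by (simp add: sum_distrib_right)
    then have eq: "sum u A - u x = 2 * sum u A * (c + 1/2) - 2 * (- u x * ((y - x) \<bullet> x))"
      using unit_simplex_weighted_sum_dist_square[OF A x'(1), of u]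
      unfolding weighted_sum_dist_square V inner_scaleR_left n(1) by linarith
    have "(y - x) \<bullet> x = - (1/2)"
      using unit n by (simp add: inner_diff inner_commute)
    from eq[unfolded this] have "c * sum u A = 0"
      by (simp add: algebra_simps)
    then show ?thesis
      using sphere by simp
  qed simp
  have "(\<Sum>a\<in>A. u a * (dist a y)\<^sup>2) = u x"
    using one_negative_direction(2)[OF A x, of y] near y \<open>sum u A = 0\<close> unit
    unfolding V inner_scaleR_left by simp
  moreover have "(\<Sum>a\<in>A. u a * (dist a y)\<^sup>2) = u x + (\<Sum>a\<in>A - {x}. u a * (dist a y)\<^sup>2)"
    using x' fin dist by (simp add: sum.remove)
  ultimately have "(\<Sum>a\<in>A - {x}. u a * (dist a y)\<^sup>2) = 0"
    by simp
  then have "u a = 0" if "a \<in> A - {x}" for a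
    using that x' fin y disjoint by (subst (asm) sum_nonneg_eq_0_iff) auto
  then have "sum u A = u x"
    using x' fin by (simp add: sum.remove)
  then show False
    using \<open>sum u A = 0\<close> x' by simp
qed

text \<open>
  Write \<open>n\<close> for the norm of \<open>V\<close>, \<open>g\<close> and \<open>h\<close> for \<open>- u x\<close> and \<open>- u y\<close>, and \<open>D\<close> for the distance of
  \<open>x\<close> and \<open>y\<close>. By the previous inequality and Cauchy-Schwarz,
  \<open>n\<^sup>2 + g * h * (1 + D\<^sup>2) / 2 - (g + h) * n * D \<le> 0\<close>. The left side decreases in \<open>D \<le> 1\<close>, and at
  \<open>D = 1\<close> it is \<open>(n - g) * (n - h) \<ge> 0\<close>. So equality holds everywhere, which forces
  \<open>V = n *\<^sub>R (y - x)\<close> with \<open>D = 1\<close> and \<open>n = g\<close> or \<open>n = h\<close>: the rigid position.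
\<close>

lemma opposite_sign_impossible:
  assumes rel: "(\<Sum>b\<in>B. u b *\<^sub>R b) = - (\<Sum>a\<in>A. u a *\<^sub>R a)" and level: "common_level A B c u"
    and x: "one_negative A u x" and y: "one_negative B u y"
    and c: "0 \<le> c" and sums: "0 \<le> sum u A * sum u B"
    and between: "0 \<le> (norm (\<Sum>a\<in>A. u a *\<^sub>R a) + u x) * (norm (\<Sum>a\<in>A. u a *\<^sub>R a) + u y)"
  shows False
proof -
  interpret swapped: disjoint_simplices B A by (rule swap)
  define V where "V = (\<Sum>a\<in>A. u a *\<^sub>R a)"
  define n D g h P where "n = norm V" and "D = dist x y" and "g = - u x" and "h = - u y"
    and "P = V \<bullet> (y - x)"
  have x': "x \<in> A" "0 < g" and y': "y \<in> B" "0 < h"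
    using x y by (auto simp: one_negative_def g_def h_def)
  have VB: "norm (\<Sum>b\<in>B. u b *\<^sub>R b) = n"
    using rel by (simp add: n_def V_def)
  \<comment> \<open>These bounds make the quadratic decrease in \<open>D\<close>.\<close>
  have half: "g \<le> 2 * n" "h \<le> 2 * n"
  proof -
    have "(u x)\<^sup>2 \<le> (\<Sum>a\<in>A. (u a)\<^sup>2)" "(u y)\<^sup>2 \<le> (\<Sum>b\<in>B. (u b)\<^sup>2)"
      using x' y' fin by (auto intro!: member_le_sum)
    moreover have "n\<^sup>2 = c * (sum u A)\<^sup>2 + (\<Sum>a\<in>A. (u a)\<^sup>2) / 2"
      unfolding n_def V_def using level
      by (intro unit_simplex_norm_combination[OF A]) (auto simp: common_level_def)
    moreover have "n\<^sup>2 = c * (sum u B)\<^sup>2 + (\<Sum>b\<in>B. (u b)\<^sup>2) / 2"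
      unfolding VB[symmetric] using level
      by (intro unit_simplex_norm_combination[OF B]) (auto simp: common_level_def)
    moreover have "0 \<le> c * (sum u A)\<^sup>2" "0 \<le> c * (sum u B)\<^sup>2"
      using c by auto
    ultimately have "g\<^sup>2 \<le> 2 * n\<^sup>2" "h\<^sup>2 \<le> 2 * n\<^sup>2"
      by (auto simp: g_def h_def)
    then have "g\<^sup>2 \<le> (2 * n)\<^sup>2" "h\<^sup>2 \<le> (2 * n)\<^sup>2"
      by (simp_all add: power_mult_distrib) (smt (verit) zero_le_power2)+
    then show "g \<le> 2 * n" "h \<le> 2 * n"
      by (auto intro: power2_le_imp_le simp: n_def)
  qed
  have D: "0 \<le> D" "D \<le> 1"
    using near x' y' by (auto simp: D_def)
  have "P \<le> n * D"
    unfolding P_def n_def D_def using norm_cauchy_schwarz[of V "y - x"]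
    by (simp add: dist_norm norm_minus_commute[of x y])
  have main: "n\<^sup>2 + g * h * (1 + D\<^sup>2) / 2 \<le> (g + h) * P"
    using opposite_sign_inequality[OF rel level x y] mult_nonneg_nonneg[OF c sums]
    by (simp add: V_def n_def g_def h_def D_def P_def)
  also have "\<dots> \<le> (g + h) * (n * D)"
    using \<open>P \<le> n * D\<close> x' y' by (intro mult_left_mono) auto
  finally have "(n - g) * (n - h) + (1 - D) * ((g + h) * n - g * h * (1 + D) / 2) \<le> 0"
    by (simp add: field_simps power2_eq_square)
  moreover have between': "0 \<le> (n - g) * (n - h)"
    using between by (simp add: n_def g_def h_def V_def)
  moreover have gap: "g * h \<le> (g + h) * n"
  proof -
    have "g * h \<le> g * (2 * n)" "h * g \<le> h * (2 * n)"
      using half x' y' by (auto intro!: mult_left_mono)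
    then show ?thesis by (simp add: algebra_simps)
  qed
  moreover have "g * h * (1 + D) / 2 < g * h" if "D < 1"
    using that x' y' by (simp add: field_simps)
  ultimately have "D = 1"
    using D by (smt (verit) mult_pos_pos)
  then have zero: "(n - g) * (n - h) = 0"
    using between' \<open>(n - g) * (n - h) + (1 - D) * ((g + h) * n - g * h * (1 + D) / 2) \<le> 0\<close> by simp
  have "(g + h) * n \<le> (g + h) * P"
    using main zero \<open>D = 1\<close> by (simp add: algebra_simps power2_eq_square)
  then have "P = n"
    using \<open>P \<le> n * D\<close> \<open>D = 1\<close> x' y' by simp
  moreover have "norm (y - x) = 1"
    using \<open>D = 1\<close> by (simp add: D_def dist_norm norm_minus_commute)
  ultimately have "V = n *\<^sub>R (y - x)"
    using norm_cauchy_schwarz_eq[of V "y - x"] by (simp add: P_def n_def)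
  from zero consider "n = g" | "n = h" by auto
  then show False
  proof cases
    case 1
    then show False
      using rigid_position_impossible[OF level x y'(1)] \<open>V = n *\<^sub>R (y - x)\<close> \<open>D = 1\<close>
      by (simp add: V_def g_def D_def)
  next
    case 2
    have "(\<Sum>b\<in>B. u b *\<^sub>R b) = - u y *\<^sub>R (x - y)"
      using rel \<open>V = n *\<^sub>R (y - x)\<close> 2 unfolding V_def[symmetric] h_def
      by (simp add: algebra_simps)
    then show False
      using swapped.rigid_position_impossible[of c u y x] level y x'(1) \<open>D = 1\<close>
      by (simp add: D_def dist_commute common_level_commute)
  qed
qed

end

lemma three_point_signs:
  assumes "card A = 3" "\<exists>a\<in>A. u a < 0" "\<exists>a\<in>A. 0 < u a"
  shows "\<exists>x. one_negative A u x \<or> one_negative A (\<lambda>z. - u z) x"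
proof -
  obtain n p where np: "n \<in> A" "u n < 0" "p \<in> A" "0 < u p"
    using assms(2,3) by blast
  then have "n \<noteq> p"
    by force
  then have "card (A - {n, p}) = 1"
    using assms(1) np card_Diff_subset[of "{n, p}" A] by simp
  then obtain r where "A - {n, p} = {r}"
    by (auto simp: card_1_singleton_iff)
  then have "A - {n} \<subseteq> {p, r}" "A - {p} \<subseteq> {n, r}"
    by auto
  then have "one_negative A u n" if "0 \<le> u r"
    using that np by (auto simp: one_negative_def)
  moreover have "one_negative A (\<lambda>z. - u z) p" if "u r < 0"
    using that np \<open>A - {p} \<subseteq> {n, r}\<close> by (auto simp: one_negative_def)
  ultimately show ?thesis
    by (cases "0 \<le> u r") auto
qed

text \<open>
  The squares of the nonnegative weights add up to at most the square of their sum, which is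
  \<open>sum u A - u x\<close>. With \<open>c \<le> 1/2\<close> this bounds the squared norm by
  \<open>(u x)\<^sup>2 + sum u A * (sum u A - u x)\<close>, and the last product is nonpositive.
\<close>

lemma norm_le_of_sum_nonpos:
  fixes A :: "'a::real_inner set"
  assumes A: "unit_simplex A" and x: "one_negative A u x" and sum: "sum u A \<le> 0"
    and c: "0 \<le> c" "c \<le> 1/2" and level: "sum u A = 0 \<or> (\<forall>a\<in>A. (norm a)\<^sup>2 = c + 1/2)"
  shows "norm (\<Sum>a\<in>A. u a *\<^sub>R a) \<le> - u x"
proof -
  have x': "x \<in> A" "u x < 0" "\<And>a. a \<in> A - {x} \<Longrightarrow> 0 \<le> u a" and fin: "finite A"
    using x A by (auto simp: one_negative_def unit_simplex_finite)
  have rest: "sum u A = u x + sum u (A - {x})"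
    using x' fin by (simp add: sum.remove)
  have "(\<Sum>a\<in>A - {x}. (u a)\<^sup>2) \<le> (\<Sum>a\<in>A - {x}. u a * sum u (A - {x}))"
    using x' fin by (auto simp: power2_eq_square intro!: sum_mono mult_left_mono member_le_sum)
  also have "\<dots> = (sum u (A - {x}))\<^sup>2"
    by (simp add: power2_eq_square sum_distrib_right)
  finally have "(\<Sum>a\<in>A. (u a)\<^sup>2) \<le> (u x)\<^sup>2 + (sum u A - u x)\<^sup>2"
    using x' fin rest by (simp add: sum.remove)
  moreover have "c * (sum u A)\<^sup>2 \<le> (sum u A)\<^sup>2 / 2"
    using mult_right_mono[OF c(2), of "(sum u A)\<^sup>2"] by simp
  ultimately have "(norm (\<Sum>a\<in>A. u a *\<^sub>R a))\<^sup>2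
      \<le> (sum u A)\<^sup>2 / 2 + ((u x)\<^sup>2 + (sum u A - u x)\<^sup>2) / 2"
    unfolding unit_simplex_norm_combination[OF A level] by argo
  also have "\<dots> = (u x)\<^sup>2 + sum u A * (sum u A - u x)"
    by (simp add: power2_eq_square field_simps)
  also have "\<dots> \<le> (u x)\<^sup>2"
  proof -
    have "0 \<le> sum u (A - {x})"
      by (intro sum_nonneg) (rule x'(3))
    then show ?thesis
      using mult_nonpos_nonneg[OF sum, of "sum u A - u x"] rest by simp
  qed
  finally show ?thesis
    using x'(2) power2_le_imp_le[of "norm (\<Sum>a\<in>A. u a *\<^sub>R a)" "- u x"] by simp
qed

section \<open>Two disjoint unit triangles of joint diameter one\<close>

definition mixed_on :: "'a set \<Rightarrow> ('a \<Rightarrow> real) \<Rightarrow> bool" where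
  "mixed_on A u \<longleftrightarrow> (\<exists>a\<in>A. u a < 0) \<and> (\<exists>a\<in>A. 0 < u a)"

lemma mixed_on_if_sum_zero:
  assumes "finite A" "sum u A = 0" "\<exists>a\<in>A. u a \<noteq> 0"
  shows "mixed_on A u"
proof -
  have "\<exists>a\<in>A. v a < 0" if "sum v A = 0" "\<exists>a\<in>A. v a \<noteq> 0" for v :: "'a \<Rightarrow> real"
    using that sum_nonneg_eq_0_iff[OF assms(1), of v] by (metis not_less)
  from this[of u] this[of "\<lambda>a. - u a"] show ?thesis
    using assms by (simp add: mixed_on_def sum_negf)
qed

locale disjoint_triangles = disjoint_simplices +
  assumes card3: "card A = 3" "card B = 3"
begin

text \<open>
  On three points, weights of both signs have a single negative or a single positive weight. Of
  the four combinations of these cases for \<open>A\<close> and \<open>B\<close>, two are excluded by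
  \<open>same_sign_impossible\<close>.
\<close>

lemma antipodal_signs:
  assumes rel: "(\<Sum>b\<in>B. u b *\<^sub>R b) = - (\<Sum>a\<in>A. u a *\<^sub>R a)" and level: "common_level A B c u"
    and "mixed_on A u" "mixed_on B u"
  obtains x y where "one_negative A u x" "one_negative B u y"
  | x y where "one_negative A (\<lambda>z. - u z) x" "one_negative B (\<lambda>z. - u z) y"
proof -
  have rel': "(\<Sum>b\<in>B. - u b *\<^sub>R b) = - (\<Sum>a\<in>A. - u a *\<^sub>R a)"
    using rel by (simp add: sum_negf)
  obtain x y where
    "one_negative A u x \<or> one_negative A (\<lambda>z. - u z) x"
    "one_negative B u y \<or> one_negative B (\<lambda>z. - u z) y"
    using three_point_signs card3 assms(3,4) unfolding mixed_on_def by metis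
  moreover have "\<not> (one_negative A u x \<and> one_negative B (\<lambda>z. - u z) y)"
    using same_sign_impossible[OF rel level] by blast
  moreover have "\<not> (one_negative A (\<lambda>z. - u z) x \<and> one_negative B u y)"
    using same_sign_impossible[OF rel'] level by (auto simp: common_level_minus)
  ultimately show ?thesis
    using that by blast
qed

lemma both_sums_nonpos_impossible:
  assumes rel: "(\<Sum>b\<in>B. u b *\<^sub>R b) = - (\<Sum>a\<in>A. u a *\<^sub>R a)" and level: "common_level A B c u"
    and x: "one_negative A u x" and y: "one_negative B u y"
    and c: "0 \<le> c" "c \<le> 1/2" and sums: "sum u A \<le> 0" "sum u B \<le> 0"
  shows False
proof (rule opposite_sign_impossible[OF rel level x y c(1)])
  show "0 \<le> sum u A * sum u B"
    using sums by (simp add: mult_nonpos_nonpos)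
  have "norm (\<Sum>a\<in>A. u a *\<^sub>R a) \<le> - u x"
    using level by (intro norm_le_of_sum_nonpos[OF A x sums(1) c]) (auto simp: common_level_def)
  moreover have "norm (\<Sum>b\<in>B. u b *\<^sub>R b) \<le> - u y"
    using level by (intro norm_le_of_sum_nonpos[OF B y sums(2) c]) (auto simp: common_level_def)
  ultimately show "0 \<le> (norm (\<Sum>a\<in>A. u a *\<^sub>R a) + u x) * (norm (\<Sum>a\<in>A. u a *\<^sub>R a) + u y)"
    using rel by (intro mult_nonpos_nonpos) auto
qed

lemma flat_triangles_impossible:
  assumes rel: "(\<Sum>b\<in>B. u b *\<^sub>R b) = - (\<Sum>a\<in>A. u a *\<^sub>R a)"
    and sums: "sum u A = 0" "sum u B = 0" and nonzero: "\<exists>z\<in>A \<union> B. u z \<noteq> 0"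
  shows False
proof -
  have level: "common_level A B 0 u" and level': "common_level A B 0 (\<lambda>z. - u z)"
    using sums by (auto simp: common_level_def sum_negf)
  have rel': "(\<Sum>b\<in>B. - u b *\<^sub>R b) = - (\<Sum>a\<in>A. - u a *\<^sub>R a)"
    using rel by (simp add: sum_negf)
  have "(\<Sum>a\<in>A. (u a)\<^sup>2) = (\<Sum>b\<in>B. (u b)\<^sup>2)"
    using unit_simplex_norm_combination[OF A, of u 0] unit_simplex_norm_combination[OF B, of u 0]
      sums rel by simp
  then have "(\<Sum>a\<in>A. (u a)\<^sup>2) = 0 \<longleftrightarrow> (\<Sum>b\<in>B. (u b)\<^sup>2) = 0"
    by simp
  then have iff: "(\<forall>a\<in>A. u a = 0) \<longleftrightarrow> (\<forall>b\<in>B. u b = 0)"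
    using fin by (simp add: sum_nonneg_eq_0_iff)
  have nz: "\<exists>a\<in>A. u a \<noteq> 0" "\<exists>b\<in>B. u b \<noteq> 0"
    by (metis UnE iff nonzero)+
  have "mixed_on A u" "mixed_on B u"
    using mixed_on_if_sum_zero[OF fin(1) sums(1) nz(1)] mixed_on_if_sum_zero[OF fin(2) sums(2) nz(2)] .
  then show False
  proof (rule antipodal_signs[OF rel level])
    fix x y assume "one_negative A u x" "one_negative B u y"
    then show False
      by (rule both_sums_nonpos_impossible[OF rel level]) (use sums in auto)
  next
    fix x y assume "one_negative A (\<lambda>z. - u z) x" "one_negative B (\<lambda>z. - u z) y"
    then show False
      by (rule both_sums_nonpos_impossible[OF rel' level']) (use sums in \<open>auto simp: sum_negf\<close>)
  qed
qed

end

lemma continuous_on_Max_image: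
  fixes f :: "'a \<Rightarrow> 'b::topological_space \<Rightarrow> real"
  assumes "finite A" "A \<noteq> {}" "\<And>a. a \<in> A \<Longrightarrow> continuous_on S (f a)"
  shows "continuous_on S (\<lambda>t. MAX a\<in>A. f a t)"
  using assms by (induction rule: finite_ne_induct) (auto intro!: continuous_on_max)

lemma one_negative_Max:
  assumes "one_negative A u x" "finite A"
  shows "(MAX a\<in>A. - u a) = - u x"
  using assms unfolding one_negative_def by (intro Max_eqI) force+

locale spherical_triangles = disjoint_triangles +
  fixes c :: real
  assumes c: "0 < c" "c \<le> 1/2" and sphere: "\<And>z. z \<in> A \<union> B \<Longrightarrow> (norm z)\<^sup>2 = c + 1/2"
begin

lemma swap_spherical: "spherical_triangles B A c"
  using swap card3 c sphere
  by (auto simp: spherical_triangles_def disjoint_triangles_def disjoint_triangles_axioms_def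
      spherical_triangles_axioms_def)

lemma level: "common_level A B c u"
  using c sphere by (simp add: common_level_def)

text \<open>
  On the sphere, \<open>a \<bullet> b \<ge> c > 0\<close> for all \<open>a\<close> in \<open>A\<close> and \<open>b\<close> in \<open>B\<close>. So a nonzero nonnegative
  combination \<open>V\<close> over \<open>A\<close> has positive inner product with every \<open>b\<close>. Since \<open>- V\<close> is the
  combination over \<open>B\<close>, the coefficient sum over \<open>B\<close> must then be negative.
\<close>

lemma nonneg_impossible:
  assumes rel: "(\<Sum>b\<in>B. u b *\<^sub>R b) = - (\<Sum>a\<in>A. u a *\<^sub>R a)" and nonzero: "\<exists>z\<in>A \<union> B. u z \<noteq> 0"
    and sums: "0 \<le> sum u A * sum u B" and nonneg: "\<forall>a\<in>A. 0 \<le> u a"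
  shows False
proof (cases "\<forall>a\<in>A. u a = 0")
  case True
  then have "(\<Sum>b\<in>B. u b *\<^sub>R b) = 0"
    using rel by simp
  then have "c * (sum u B)\<^sup>2 + (\<Sum>b\<in>B. (u b)\<^sup>2) / 2 = 0"
    using unit_simplex_norm_combination[OF B, of u c] sphere by simp
  moreover have "0 \<le> c * (sum u B)\<^sup>2" "0 \<le> (\<Sum>b\<in>B. (u b)\<^sup>2)"
    using c by (auto intro: sum_nonneg)
  ultimately have "(\<Sum>b\<in>B. (u b)\<^sup>2) = 0"
    by linarith
  then show False
    using True nonzero fin by (simp add: sum_nonneg_eq_0_iff) blast
next
  case False
  then have pos: "0 < sum u A"
    using nonneg sum_nonneg[of A u] sum_nonneg_eq_0_iff[OF fin(1), of u] by fastforce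
  have inner_ge: "c \<le> a \<bullet> b" if "a \<in> A" "b \<in> B" for a b
  proof -
    have "(dist a b)\<^sup>2 \<le> 1"
      using near[OF that] by (simp add: power_le_one)
    moreover have "a \<bullet> a = c + 1/2" "b \<bullet> b = c + 1/2"
      using sphere that by (simp_all flip: power2_norm_eq_inner)
    ultimately show ?thesis
      unfolding dist_square_inner by linarith
  qed
  have neg: "2 * c * sum u B + u b < 0" if "b \<in> B" for b
  proof -
    have "c * sum u A \<le> (\<Sum>a\<in>A. u a *\<^sub>R a) \<bullet> b"
      unfolding inner_sum_left sum_distrib_left using inner_ge that nonneg
      by (intro sum_mono) (auto simp: mult.commute[of c] intro!: mult_left_mono)
    moreover have "0 < c * sum u A"
      using pos c by simp
    moreover have "(\<Sum>a\<in>B. u a * (a \<bullet> a)) = sum u B * (c + 1/2)"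
      using sphere by (simp add: power2_norm_eq_inner sum_distrib_right)
    then have "(\<Sum>a\<in>B. u a *\<^sub>R a) \<bullet> b = c * sum u B + u b / 2"
      using unit_simplex_weighted_sum_dist_square[OF B that, of u] sphere[of b] that
      unfolding weighted_sum_dist_square by (simp add: power2_norm_eq_inner algebra_simps)
    ultimately show ?thesis
      using rel by simp
  qed
  have "(\<Sum>b\<in>B. 2 * c * sum u B + u b) < (\<Sum>b\<in>B. 0)"
    using neg fin card3 by (intro sum_strict_mono) auto
  then have "(6 * c + 1) * sum u B < 0"
    using card3 by (simp add: sum.distrib algebra_simps)
  then have "sum u B < 0"
    using c by (simp add: mult_less_0_iff)
  then show False
    using pos sums by (simp add: zero_le_mult_iff)
qed

lemma relation_mixed_left:
  assumes rel: "(\<Sum>b\<in>B. u b *\<^sub>R b) = - (\<Sum>a\<in>A. u a *\<^sub>R a)" and nonzero: "\<exists>z\<in>A \<union> B. u z \<noteq> 0"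
    and sums: "0 \<le> sum u A * sum u B"
  shows "mixed_on A u"
proof -
  have "(\<Sum>b\<in>B. - u b *\<^sub>R b) = - (\<Sum>a\<in>A. - u a *\<^sub>R a)"
    using rel by (simp add: sum_negf)
  from nonneg_impossible[OF this] nonneg_impossible[OF rel] show ?thesis
    using nonzero sums by (auto simp: mixed_on_def sum_negf not_less) (meson not_less)+
qed

lemma relation_signs:
  assumes rel: "(\<Sum>b\<in>B. u b *\<^sub>R b) = - (\<Sum>a\<in>A. u a *\<^sub>R a)" and nonzero: "\<exists>z\<in>A \<union> B. u z \<noteq> 0"
    and sums: "0 \<le> sum u A * sum u B"
  obtains x y where "one_negative A u x" "one_negative B u y"
  | x y where "one_negative A (\<lambda>z. - u z) x" "one_negative B (\<lambda>z. - u z) y"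
proof -
  interpret swapped: spherical_triangles B A c
    by (rule swap_spherical)
  have "mixed_on A u" "mixed_on B u"
    using relation_mixed_left[OF assms] swapped.relation_mixed_left[of u] rel nonzero sums
    by (auto simp: mult.commute)
  with antipodal_signs[OF rel level] that show ?thesis
    by blast
qed

text \<open>
  When the coefficient sum over \<open>A\<close> vanishes, the norm of the combination is at most the largest
  \<open>- v a\<close>. It must lie strictly between the two extreme coefficients by
  \<open>opposite_sign_impossible\<close>, which determines the order of these.
\<close>

lemma unbalanced_relation:
  assumes rel: "(\<Sum>b\<in>B. u b *\<^sub>R b) = - (\<Sum>a\<in>A. u a *\<^sub>R a)" and nonzero: "\<exists>z\<in>A \<union> B. u z \<noteq> 0"
    and sum: "sum u A = 0"
  obtains v where "(\<Sum>b\<in>B. v b *\<^sub>R b) = - (\<Sum>a\<in>A. v a *\<^sub>R a)" "sum v A = 0" "0 < sum v B"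
    "(MAX b\<in>B. - v b) < (MAX a\<in>A. - v a)"
proof -
  have rel': "(\<Sum>b\<in>B. - u b *\<^sub>R b) = - (\<Sum>a\<in>A. - u a *\<^sub>R a)"
    using rel by (simp add: sum_negf)
  obtain v x y where v: "(\<Sum>b\<in>B. v b *\<^sub>R b) = - (\<Sum>a\<in>A. v a *\<^sub>R a)" "sum v A = 0"
    and x: "one_negative A v x" and y: "one_negative B v y"
    using relation_signs[OF rel nonzero] sum rel rel'
    by (metis mult_zero_left order_refl sum_negf neg_equal_0_iff_equal)
  have pos: "0 < sum v B"
    using both_sums_nonpos_impossible[OF v(1) level x y] c v(2) by force
  have "norm (\<Sum>a\<in>A. v a *\<^sub>R a) \<le> - v x"
    using norm_le_of_sum_nonpos[OF A x, of c] v(2) c by simp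
  moreover have "(norm (\<Sum>a\<in>A. v a *\<^sub>R a) + v x) * (norm (\<Sum>a\<in>A. v a *\<^sub>R a) + v y) < 0"
    using opposite_sign_impossible[OF v(1) level x y] c v(2) by force
  ultimately have "- v y < - v x"
    by (auto simp: mult_less_0_iff)
  then show ?thesis
    using that[OF v pos] one_negative_Max[OF x] one_negative_Max[OF y] fin by simp
qed

text \<open>
  By \<open>unbalanced_relation\<close>, the suitably signed relations with vanishing sum over \<open>A\<close> and over \<open>B\<close>
  order the largest \<open>- u a\<close> and the largest \<open>- u b\<close> differently. Somewhere on the segment between
  the two relations these maxima agree, while both coefficient sums are positive. There
  \<open>opposite_sign_impossible\<close> applies; if the signs are reversed instead, both sums are negative and
  \<open>both_sums_nonpos_impossible\<close> applies.
\<close>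

lemma spherical_triangles_impossible:
  assumes "(\<Sum>b\<in>B. u b *\<^sub>R b) = - (\<Sum>a\<in>A. u a *\<^sub>R a)" "\<exists>z\<in>A \<union> B. u z \<noteq> 0" "sum u A = 0"
    and "(\<Sum>b\<in>B. v b *\<^sub>R b) = - (\<Sum>a\<in>A. v a *\<^sub>R a)" "\<exists>z\<in>A \<union> B. v z \<noteq> 0" "sum v B = 0"
  shows False
proof -
  interpret swapped: spherical_triangles B A c
    by (rule swap_spherical)
  obtain p where p: "(\<Sum>b\<in>B. p b *\<^sub>R b) = - (\<Sum>a\<in>A. p a *\<^sub>R a)" "sum p A = 0" "0 < sum p B"
    "(MAX b\<in>B. - p b) < (MAX a\<in>A. - p a)"
    using unbalanced_relation[OF assms(1-3)] by blast
  obtain q where q: "(\<Sum>b\<in>B. q b *\<^sub>R b) = - (\<Sum>a\<in>A. q a *\<^sub>R a)" "sum q B = 0" "0 < sum q A"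
    "(MAX a\<in>A. - q a) < (MAX b\<in>B. - q b)"
  proof (rule swapped.unbalanced_relation[of v])
    show "(\<Sum>a\<in>A. v a *\<^sub>R a) = - (\<Sum>b\<in>B. v b *\<^sub>R b)" "sum v B = 0"
      using assms(4,6) by simp_all
    show "\<exists>z\<in>B \<union> A. v z \<noteq> 0"
      using assms(5) by (simp add: Un_commute)
    fix q assume "(\<Sum>a\<in>A. q a *\<^sub>R a) = - (\<Sum>b\<in>B. q b *\<^sub>R b)" "sum q B = 0" "0 < sum q A"
      "(MAX a\<in>A. - q a) < (MAX b\<in>B. - q b)"
    then show thesis
      by (intro that[of q]) simp_all
  qed
  define w where "w t z = (1 - t) * p z + t * q z" for t z
  define F where "F t = (MAX b\<in>B. - w t b) - (MAX a\<in>A. - w t a)" for t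
  have ne: "A \<noteq> {}" "B \<noteq> {}"
    using card3 by auto
  have cont: "continuous_on {0..1} F"
    unfolding F_def w_def using fin ne
    by (intro continuous_on_diff continuous_on_Max_image) (auto intro!: continuous_intros)
  have "F 0 < 0" "0 < F 1"
    using p(4) q(4) by (simp_all add: F_def w_def)
  then obtain t where t: "0 \<le> t" "t \<le> 1" "F t = 0"
    using IVT'[of F 0 0 1] cont by auto
  then have "t \<noteq> 0" "t \<noteq> 1"
    using \<open>F 0 < 0\<close> \<open>0 < F 1\<close> by auto
  then have t01: "0 < t" "t < 1"
    using t by auto
  have combo: "(\<Sum>z\<in>C. w t z *\<^sub>R z)
      = (1 - t) *\<^sub>R (\<Sum>z\<in>C. p z *\<^sub>R z) + t *\<^sub>R (\<Sum>z\<in>C. q z *\<^sub>R z)" for C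
    by (simp add: w_def scaleR_sum_right sum.distrib scaleR_add_left)
  have rel: "(\<Sum>b\<in>B. w t b *\<^sub>R b) = - (\<Sum>a\<in>A. w t a *\<^sub>R a)"
    unfolding combo p(1) q(1) by simp
  then have rel': "(\<Sum>b\<in>B. - w t b *\<^sub>R b) = - (\<Sum>a\<in>A. - w t a *\<^sub>R a)"
    by (simp add: sum_negf)
  have "sum (w t) C = (1 - t) * sum p C + t * sum q C" for C
    by (simp add: w_def sum.distrib sum_distrib_left)
  then have pos: "0 < sum (w t) A" "0 < sum (w t) B"
    using p q t01 by auto
  then have nonzero: "\<exists>z\<in>A \<union> B. w t z \<noteq> 0"
    by (metis UnCI less_irrefl sum.neutral)
  show False
  proof (rule relation_signs[OF rel nonzero])
    show "0 \<le> sum (w t) A * sum (w t) B"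
      using pos by simp
  next
    fix x y assume x: "one_negative A (w t) x" and y: "one_negative B (w t) y"
    have "w t x = w t y"
      using t(3) one_negative_Max[OF x] one_negative_Max[OF y] fin by (simp add: F_def)
    then show False
      using opposite_sign_impossible[OF rel level x y] c pos by simp
  next
    fix x y assume x: "one_negative A (\<lambda>z. - w t z) x" and y: "one_negative B (\<lambda>z. - w t z) y"
    show False
      using both_sums_nonpos_impossible[OF rel' level x y] c pos by (simp add: sum_negf)
  qed
qed

end

section \<open>Points equidistant from a unit simplex\<close>

lemma exists_linear_relation:
  fixes Z U :: "'a::euclidean_space set"
  assumes "finite Z" "Z \<subseteq> U" "dim U < card Z"
  obtains u where "\<exists>z\<in>Z. u z \<noteq> 0" "(\<Sum>z\<in>Z. u z *\<^sub>R z) = 0"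
proof -
  have "dependent Z"
    using independent_card_le_dim[OF assms(2)] assms(3) by linarith
  then show ?thesis
    using that assms(1) by (auto simp: dependent_finite)
qed

text \<open>
  Each point \<open>z\<close> is replaced by the pair of \<open>z\<close> and \<open>f z\<close> in a product space; a linear relation
  there is a relation that satisfies the additional condition.
\<close>

lemma exists_linear_relation_with_condition:
  fixes Z U :: "'a::euclidean_space set" and f :: "'a \<Rightarrow> 'b::euclidean_space"
  assumes "finite Z" "Z \<subseteq> U" "dim U + DIM('b) < card Z"
  obtains u where "\<exists>z\<in>Z. u z \<noteq> 0" "(\<Sum>z\<in>Z. u z *\<^sub>R z) = 0" "(\<Sum>z\<in>Z. u z *\<^sub>R f z) = 0"
proof -
  define g where "g z = (z, f z)" for z
  have inj: "inj_on g Z"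
    by (auto simp: g_def inj_on_def)
  have "dim (span U \<times> (UNIV :: 'b set)) = dim U + DIM('b)"
    by (subst dim_Times) auto
  then have less: "dim (span U \<times> (UNIV :: 'b set)) < card (g ` Z)"
    using assms(3) card_image[OF inj] by simp
  have sub: "g ` Z \<subseteq> span U \<times> UNIV"
    using assms(2) span_superset by (auto simp: g_def)
  obtain h where h: "\<exists>p\<in>g ` Z. h p \<noteq> 0" "(\<Sum>p\<in>g ` Z. h p *\<^sub>R p) = 0"
    by (rule exists_linear_relation[OF finite_imageI[OF assms(1)] sub less])
  then have "(\<Sum>z\<in>Z. h (g z) *\<^sub>R g z) = 0"
    by (simp add: sum.reindex[OF inj])
  then have "(\<Sum>z\<in>Z. h (g z) *\<^sub>R fst (g z)) = 0" "(\<Sum>z\<in>Z. h (g z) *\<^sub>R snd (g z)) = 0"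
    by (metis (no_types, lifting) fst_scaleR fst_sum fst_zero sum.cong,
        metis (no_types, lifting) snd_scaleR snd_sum snd_zero sum.cong)
  then show ?thesis
    using h(1) that[of "h \<circ> g"] by (simp add: g_def)
qed

definition centroid :: "'a::real_vector set \<Rightarrow> 'a" where
  "centroid K = (1 / real (card K)) *\<^sub>R (\<Sum>p\<in>K. p)"

lemma sum_dist_square_centroid:
  fixes K :: "'a::real_inner set"
  assumes "finite K" "K \<noteq> {}"
  shows "(\<Sum>p\<in>K. (dist p z)\<^sup>2)
    = real (card K) * (dist z (centroid K))\<^sup>2 + (\<Sum>p\<in>K. (dist p (centroid K))\<^sup>2)"
proof -
  have eq: "(\<Sum>p\<in>K. p) = real (card K) *\<^sub>R centroid K"
    using assms by (simp add: centroid_def)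
  have "(\<Sum>p\<in>K. (dist p y)\<^sup>2)
      = (\<Sum>p\<in>K. p \<bullet> p) + real (card K) * (y \<bullet> y - 2 * (centroid K \<bullet> y))" for y
    using weighted_sum_dist_square[where u = "\<lambda>_. 1" and A = K and z = y]
    by (simp add: eq right_diff_distrib)
  then show ?thesis
    unfolding dist_square_inner[of z]
    by (simp add: inner_commute[of z "centroid K"] right_diff_distrib distrib_left)
qed

lemma unit_simplex_sum_dist_square_centroid:
  fixes K :: "'a::real_inner set"
  assumes K: "unit_simplex K" "K \<noteq> {}"
  shows "(\<Sum>p\<in>K. (dist p (centroid K))\<^sup>2) = (real (card K) - 1) / 2"
proof -
  let ?T = "\<Sum>p\<in>K. (dist p (centroid K))\<^sup>2"
  have fin: "finite K" and pos: "0 < real (card K)"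
    using K unit_simplex_finite by (auto simp: card_gt_0_iff)
  have "real (card K) - 1 = real (card K) * (dist q (centroid K))\<^sup>2 + ?T" if "q \<in> K" for q
    using sum_dist_square_centroid[OF fin K(2), of q]
      unit_simplex_weighted_sum_dist_square[OF K(1) that, of "\<lambda>_. 1"] by simp
  then have "(\<Sum>q\<in>K. real (card K) - 1) = (\<Sum>q\<in>K. real (card K) * (dist q (centroid K))\<^sup>2 + ?T)"
    by (rule sum.cong[OF refl])
  then have "real (card K) * (real (card K) - 1) = real (card K) * (2 * ?T)"
    by (simp add: sum.distrib sum_distrib_left[symmetric])
  then show ?thesis
    using pos by simp
qed

text \<open>
  The distance to one vertex \<open>a\<close> is left arbitrary because \<open>middle_point_has_one_neighbour\<close>
  evaluates the norm at a point that need not be adjacent to \<open>a\<close>.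
\<close>

lemma norm_minus_centroid:
  fixes K :: "'a::real_inner set"
  assumes K: "unit_simplex K" and a: "a \<in> K" and z: "\<And>p. p \<in> K - {a} \<Longrightarrow> dist z p = 1"
  shows "(norm (z - centroid K))\<^sup>2
    = 1/2 + 1 / (2 * real (card K)) + ((dist z a)\<^sup>2 - 1) / real (card K)"
proof -
  have fin: "finite K" and ne: "K \<noteq> {}" and pos: "0 < real (card K)"
    using K a unit_simplex_finite by (auto simp: card_gt_0_iff)
  have "(\<Sum>p\<in>K. (dist p z)\<^sup>2) = (dist z a)\<^sup>2 + (\<Sum>p\<in>K - {a}. (dist p z)\<^sup>2)"
    using fin a by (simp add: sum.remove dist_commute)
  also have "(\<Sum>p\<in>K - {a}. (dist p z)\<^sup>2) = (\<Sum>p\<in>K - {a}. 1)"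
    using z by (intro sum.cong) (auto simp: dist_commute)
  also have "\<dots> = real (card K) - 1"
    using fin a pos by (simp add: of_nat_diff)
  finally have "real (card K) * (dist z (centroid K))\<^sup>2
      = (dist z a)\<^sup>2 + (real (card K) - 1) - (real (card K) - 1) / 2"
    using sum_dist_square_centroid[OF fin ne, of z] unit_simplex_sum_dist_square_centroid[OF K ne]
    by linarith
  then have "(dist z (centroid K))\<^sup>2 = ((dist z a)\<^sup>2 + (real (card K) - 1) / 2) / real (card K)"
    using pos by (simp add: eq_divide_eq mult.commute field_split_simps)
  also have "\<dots> = 1/2 + 1 / (2 * real (card K)) + ((dist z a)\<^sup>2 - 1) / real (card K)"
    using pos by (simp add: add_divide_distrib diff_divide_distrib)
  finally show ?thesis
    by (simp add: dist_norm)
qed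

corollary norm_minus_centroid_equidistant:
  fixes K :: "'a::real_inner set"
  assumes "unit_simplex K" "K \<noteq> {}" "\<And>p. p \<in> K \<Longrightarrow> dist z p = 1"
  shows "(norm (z - centroid K))\<^sup>2 = 1/2 + 1 / (2 * real (card K))"
  using norm_minus_centroid[OF assms(1), of _ z] assms(2,3) by force

definition normal_space :: "'a::real_inner set \<Rightarrow> 'a set" where
  "normal_space K = {z. \<forall>p\<in>K. \<forall>q\<in>K. (p - q) \<bullet> z = 0}"

lemma equidistant_in_normal_space:
  fixes K :: "'a::real_inner set"
  assumes K: "unit_simplex K" "K \<noteq> {}" and z: "\<And>p. p \<in> K \<Longrightarrow> dist z p = 1"
  shows "z - centroid K \<in> normal_space K"
proof -
  have fin: "finite K" and pos: "0 < real (card K)"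
    using K unit_simplex_finite by (auto simp: card_gt_0_iff)
  have eq: "(dist p (centroid K))\<^sup>2 = (real (card K) - 1) / (2 * real (card K))" if "p \<in> K" for p
  proof -
    have "(\<Sum>q\<in>K. (dist q p)\<^sup>2) = real (card K) - 1"
      using unit_simplex_weighted_sum_dist_square[OF K(1) that, of "\<lambda>_. 1"] by simp
    then show ?thesis
      using sum_dist_square_centroid[OF fin K(2), of p] unit_simplex_sum_dist_square_centroid[OF K] pos
      by (simp add: field_simps)
  qed
  have "(p - q) \<bullet> (z - centroid K) = 0" if "p \<in> K" "q \<in> K" for p q
  proof -
    have "(dist p z)\<^sup>2 = (dist q z)\<^sup>2" "(dist p (centroid K))\<^sup>2 = (dist q (centroid K))\<^sup>2"
      using z eq that by (simp_all add: dist_commute)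
    then show ?thesis
      unfolding dist_square_inner by (simp add: inner_diff)
  qed
  then show ?thesis
    by (simp add: normal_space_def)
qed

text \<open>
  The differences to a base vertex are independent: a linear relation between them is a
  combination of the vertices with weights of sum zero, whose squared norm is half the sum of the
  squared weights by \<open>unit_simplex_norm_combination\<close>.
\<close>

lemma dim_normal_space:
  fixes K :: "'a::euclidean_space set"
  assumes K: "unit_simplex K" "K \<noteq> {}"
  shows "dim (normal_space K) + card K = DIM('a) + 1"
proof -
  obtain base where base: "base \<in> K"
    using K by blast
  have fin: "finite K"
    using K unit_simplex_finite by blast
  let ?g = "\<lambda>p. p - base"
  define T where "T = ?g ` (K - {base})"
  have inj: "inj_on ?g (K - {base})"
    by (simp add: inj_on_def)
  have "card T = card (K - {base})"
    unfolding T_def by (rule card_image[OF inj])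
  then have card_T: "card T + 1 = card K"
    using card.remove[OF fin base] by simp
  have "independent T"
  proof
    assume "dependent T"
    moreover have "finite T"
      using fin by (simp add: T_def)
    ultimately obtain h where h: "\<exists>t\<in>T. h t \<noteq> 0" "(\<Sum>t\<in>T. h t *\<^sub>R t) = 0"
      by (auto simp: dependent_finite)
    define s where "s = (\<Sum>p\<in>K - {base}. h (p - base))"
    define u where "u p = (if p = base then - s else h (p - base))" for p
    have "(\<Sum>p\<in>K - {base}. u p) = s"
      by (auto simp: u_def s_def intro: sum.cong)
    then have sum: "sum u K = 0"
      using fin base by (simp add: sum.remove u_def)
    have "(\<Sum>p\<in>K - {base}. h (p - base) *\<^sub>R (p - base)) = 0"
      using h(2) inj by (simp add: T_def sum.reindex)
    then have "(\<Sum>p\<in>K - {base}. h (p - base) *\<^sub>R p) = s *\<^sub>R base"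
      by (simp add: scaleR_diff_right sum_subtractf s_def scaleR_left.sum)
    moreover have "(\<Sum>p\<in>K - {base}. u p *\<^sub>R p) = (\<Sum>p\<in>K - {base}. h (p - base) *\<^sub>R p)"
      by (auto simp: u_def intro: sum.cong)
    ultimately have "(\<Sum>p\<in>K. u p *\<^sub>R p) = 0"
      using fin base by (simp add: sum.remove u_def)
    then have "(\<Sum>p\<in>K. (u p)\<^sup>2) = 0"
      using unit_simplex_norm_combination[OF K(1), of u 0] sum by simp
    then have zero: "\<forall>p\<in>K. u p = 0"
      using fin by (simp add: sum_nonneg_eq_0_iff)
    obtain p where "p \<in> K - {base}" "h (p - base) \<noteq> 0"
      using h(1) by (auto simp: T_def)
    then show False
      using bspec[OF zero, of p] by (simp add: u_def)
  qed
  have "normal_space K = {y. \<forall>x\<in>T. orthogonal x y}"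
  proof -
    have "(p - q) \<bullet> z = 0" if "\<forall>x\<in>T. orthogonal x z" "p \<in> K" "q \<in> K" for p q z
    proof -
      have "(r - base) \<bullet> z = 0" if "r \<in> K" for r
        using \<open>\<forall>x\<in>T. orthogonal x z\<close> that by (cases "r = base") (auto simp: T_def orthogonal_def)
      from this[OF that(2)] this[OF that(3)] show ?thesis
        by (simp add: inner_diff_left)
    qed
    then show ?thesis
      using base by (auto simp: normal_space_def T_def orthogonal_def)
  qed
  also have "\<dots> = {y \<in> UNIV. \<forall>x\<in>span T. orthogonal x y}"
    by (auto intro: span_base)
      (metis orthogonal_commute orthogonal_to_span)
  finally have "dim (normal_space K) + dim (span T) = DIM('a)"
    using dim_subspace_orthogonal_to_vectors[of "span T" UNIV] by simp
  then show ?thesis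
    using card_T \<open>independent T\<close> by (simp add: dim_eq_card_independent)
qed

lemma unit_simplex_translate:
  fixes K :: "'a::real_normed_vector set"
  assumes "unit_simplex K"
  shows "unit_simplex ((\<lambda>z. z - v) ` K)"
  using assms by (auto simp: unit_simplex_def pairwise_def dist_norm)

text \<open>
  Six points in dimension 3 have a relation with two prescribed coefficient sums, and six points in
  dimension 4 have one with a single prescribed sum. The second applies when the simplices share a
  vertex, because the space normal to the \<open>d - 3\<close> common vertices has dimension 4.
\<close>

theorem simplices_share_not_codimension_three:
  fixes K L :: "'a::euclidean_space set"
  assumes K: "unit_simplex K" "card K = DIM('a)" and L: "unit_simplex L" "card L = DIM('a)"
    and near: "\<And>p q. \<lbrakk>p \<in> K; q \<in> L\<rbrakk> \<Longrightarrow> dist p q \<le> 1" and dim: "3 \<le> DIM('a)"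
  shows "card (K \<inter> L) \<noteq> DIM('a) - 3"
proof
  assume M: "card (K \<inter> L) = DIM('a) - 3"
  define center where "center = centroid (K \<inter> L)"
  define A where "A = (\<lambda>z. z - center) ` (K - L)"
  define B where "B = (\<lambda>z. z - center) ` (L - K)"
  have fin_KL: "finite K" "finite L"
    using K L unit_simplex_finite by auto
  have inj: "inj_on (\<lambda>z. z - center) C" for C
    by (simp add: inj_on_def)
  have card: "card A = 3" "card B = 3"
    using fin_KL K(2) L(2) M dim card_image[OF inj] card_Diff_subset_Int[of K L] card_Diff_subset_Int[of L K]
    by (simp_all add: A_def B_def Int_commute)
  interpret disjoint_triangles A B
  proof
    show "unit_simplex A" "unit_simplex B"
      unfolding A_def B_def using K(1) L(1)
      by (auto intro!: unit_simplex_translate elim: unit_simplex_subset)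
    show "A \<inter> B = {}" by (auto simp: A_def B_def)
    show "card A = 3" "card B = 3" by fact+
    show "dist a b \<le> 1" if "a \<in> A" "b \<in> B" for a b
      using that near by (auto simp: A_def B_def dist_norm)
  qed
  have fin_AB: "finite A" "finite B" "finite (A \<union> B)"
    using fin_KL by (auto simp: A_def B_def)
  then have card6: "card (A \<union> B) = 6"
    using card disjoint by (simp add: card_Un_disjoint)
  have split: "(\<Sum>z\<in>A \<union> B. h z) = (\<Sum>z\<in>A. h z) + (\<Sum>z\<in>B. h z)" for h :: "'a \<Rightarrow> 'b::comm_monoid_add"
    using fin_AB disjoint by (intro sum.union_disjoint)
  have ind: "(\<Sum>z\<in>A. u z * indicator A z) = sum u A" "(\<Sum>z\<in>B. u z * indicator A z) = 0"
      "(\<Sum>z\<in>A. u z * indicator B z) = 0" "(\<Sum>z\<in>B. u z * indicator B z) = sum u B" for u :: "'a \<Rightarrow> real"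
    using disjoint by (auto intro!: sum.cong sum.neutral simp: indicator_def)
  show False
  proof (cases "K \<inter> L = {}")
    case True
    then have "DIM('a) = 3"
      using M dim by simp
    then have "dim (UNIV :: 'a set) + DIM(real \<times> real) < card (A \<union> B)"
      by (simp add: card6)
    then obtain u where u: "\<exists>z\<in>A \<union> B. u z \<noteq> 0" "(\<Sum>z\<in>A \<union> B. u z *\<^sub>R z) = 0"
      "(\<Sum>z\<in>A \<union> B. u z *\<^sub>R (indicator A z :: real, indicator B z :: real)) = 0"
      by (rule exists_linear_relation_with_condition[OF fin_AB(3) subset_UNIV])
    have "(\<Sum>z\<in>A \<union> B. u z * indicator A z) = 0" "(\<Sum>z\<in>A \<union> B. u z * indicator B z) = 0"
      using arg_cong[OF u(3), of fst] arg_cong[OF u(3), of snd]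
      by (simp_all only: fst_sum snd_sum fst_scaleR snd_scaleR fst_conv snd_conv fst_zero snd_zero
          real_scaleR_def)
    then have "sum u A = 0" "sum u B = 0"
      by (simp_all only: split ind add_0_left add_0_right)
    then show False
      using flat_triangles_impossible[of u] u(1,2) by (simp add: split add_eq_0_iff)
  next
    case False
    have M': "unit_simplex (K \<inter> L)"
      using K(1) by (auto elim: unit_simplex_subset)
    have equidistant: "dist z p = 1" if "z \<in> (K - L) \<union> (L - K)" "p \<in> K \<inter> L" for z p
      using that unit_simplex_dist[OF K(1), of z p] unit_simplex_dist[OF L(1), of z p] by auto
    have "4 \<le> DIM('a)"
    proof -
      have "0 < card (K \<inter> L)"
        using False fin_KL by (simp add: card_gt_0_iff)
      then show ?thesis
        unfolding M by linarith
    qed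
    then have dim4: "dim (normal_space (K \<inter> L)) = 4"
      using dim_normal_space[OF M' False] M by simp
    have normal: "A \<union> B \<subseteq> normal_space (K \<inter> L)"
      unfolding A_def B_def center_def using equidistant
      by (auto intro!: equidistant_in_normal_space[OF M' False])
    define c where "c = 1 / (2 * real (card (K \<inter> L)))"
    interpret spherical_triangles A B c
    proof
      have "1 \<le> real (card (K \<inter> L))"
        using False fin_KL by (simp add: Suc_le_eq card_gt_0_iff)
      then show "0 < c" "c \<le> 1/2"
        by (auto simp: c_def field_simps)
      show "(norm z)\<^sup>2 = c + 1/2" if "z \<in> A \<union> B" for z
        using that norm_minus_centroid_equidistant[OF M' False] equidistant
        by (auto simp: A_def B_def c_def center_def)
    qed
    have less: "dim (normal_space (K \<inter> L)) + DIM(real) < card (A \<union> B)"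
      using dim4 card6 by simp
    obtain u where u: "\<exists>z\<in>A \<union> B. u z \<noteq> 0" "(\<Sum>z\<in>A \<union> B. u z *\<^sub>R z) = 0"
      "(\<Sum>z\<in>A \<union> B. u z *\<^sub>R (indicator A z :: real)) = 0"
      by (rule exists_linear_relation_with_condition[OF fin_AB(3) normal less])
    obtain v where v: "\<exists>z\<in>A \<union> B. v z \<noteq> 0" "(\<Sum>z\<in>A \<union> B. v z *\<^sub>R z) = 0"
      "(\<Sum>z\<in>A \<union> B. v z *\<^sub>R (indicator B z :: real)) = 0"
      by (rule exists_linear_relation_with_condition[OF fin_AB(3) normal less])
    show False
      using spherical_triangles_impossible[of u v] u v by (simp add: split ind add_eq_0_iff)
  qed
qed

text \<open>
  Two different apices would be opposite to each other on the line through the centroid normal to \<open>K\<close>, at height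
  at least \<open>sqrt (1/2)\<close>, so their distance would exceed 1.
\<close>

lemma apex_unique:
  fixes K :: "'a::euclidean_space set"
  assumes K: "unit_simplex K" "card K = DIM('a)"
    and x: "\<And>p. p \<in> K \<Longrightarrow> dist x p = 1" and y: "\<And>p. p \<in> K \<Longrightarrow> dist y p = 1"
    and near: "dist x y \<le> 1"
  shows "x = y"
proof (rule ccontr)
  assume "x \<noteq> y"
  have ne: "K \<noteq> {}"
    using K(2) by auto
  define X Y where "X = x - centroid K" and "Y = y - centroid K"
  have "X \<noteq> Y"
    using \<open>x \<noteq> y\<close> by (simp add: X_def Y_def)
  have nX: "(norm X)\<^sup>2 = 1/2 + 1 / (2 * real (card K))" and nY: "(norm Y)\<^sup>2 = 1/2 + 1 / (2 * real (card K))"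
    unfolding X_def Y_def using norm_minus_centroid_equidistant[OF K(1) ne] x y by auto
  have "dim (normal_space K) = 1"
    using dim_normal_space[OF K(1) ne] K(2) by simp
  moreover have "{X, Y} \<subseteq> normal_space K"
    unfolding X_def Y_def using equidistant_in_normal_space[OF K(1) ne] x y by auto
  ultimately obtain u where u: "u X \<noteq> 0 \<or> u Y \<noteq> 0" "u X *\<^sub>R X + u Y *\<^sub>R Y = 0"
    using exists_linear_relation[of "{X, Y}" "normal_space K"] \<open>X \<noteq> Y\<close> by auto
  have pos: "0 < (norm X)\<^sup>2"
    unfolding nX by (simp add: add_pos_nonneg)
  have same: "norm X = norm Y"
    using nX nY by (metis norm_ge_zero power2_eq_iff_nonneg)
  have "norm (u X *\<^sub>R X) = norm (u Y *\<^sub>R Y)"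
    using u(2) by (metis add.inverse_inverse add_eq_0_iff norm_minus_cancel)
  then have "\<bar>u X\<bar> = \<bar>u Y\<bar>"
    using same pos by simp
  then consider "u X = u Y" | "u X = - u Y"
    by linarith
  then have "X = - Y"
  proof cases
    case 1
    then have "u X *\<^sub>R (X + Y) = 0" using u(2) by (simp add: scaleR_add_right)
    then show ?thesis using u(1) 1 by (simp add: add_eq_0_iff2)
  next
    case 2
    then have "u X *\<^sub>R (X - Y) = 0" using u(2) by (simp add: scaleR_diff_right)
    then show ?thesis using u(1) 2 \<open>X \<noteq> Y\<close> by simp
  qed
  have "dist x y = norm (X - Y)"
    by (simp add: X_def Y_def dist_norm)
  also have "\<dots> = 2 * norm X"
  proof -
    have "X - Y = 2 *\<^sub>R X"
      using \<open>X = - Y\<close> by (simp add: scaleR_2)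
    then show ?thesis by simp
  qed
  finally have "(2 * norm X)\<^sup>2 \<le> 1"
    using near power_le_one[of "dist x y" 2] by simp
  moreover have "1/2 \<le> (norm X)\<^sup>2"
    unfolding nX by simp
  ultimately show False
    by (simp add: power_mult_distrib)
qed

text \<open>
  The three points of \<open>C\<close> lie on a circle in the plane through the centroid normal to \<open>K\<close>, with
  angles of less than a right angle. Relative to the centre, the middle point \<open>q\<close> is a combination
  of the others with nonnegative coefficients of sum greater than 1. A point \<open>b \<noteq> a\<close> adjacent to the
  other vertices of \<open>K\<close> has inner product at least \<open>k > 0\<close> with every point of \<open>C\<close>, so its inner
  product with \<open>q\<close> exceeds \<open>k\<close>. Equality, which is adjacency of \<open>b\<close> and \<open>q\<close>, is excluded.
\<close>

lemma middle_point_has_one_neighbour: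
  fixes K C :: "'a::euclidean_space set"
  assumes K: "unit_simplex K" "card K + 1 = DIM('a)" "K \<noteq> {}"
    and C: "card C = 3" "\<And>x p. \<lbrakk>x \<in> C; p \<in> K\<rbrakk> \<Longrightarrow> dist x p = 1"
      "\<And>x y. \<lbrakk>x \<in> C; y \<in> C\<rbrakk> \<Longrightarrow> dist x y \<le> 1"
  obtains q where "q \<in> C"
    "\<And>a b. \<lbrakk>a \<in> K; \<And>p. p \<in> K - {a} \<Longrightarrow> dist b p = 1; \<And>x. x \<in> C \<Longrightarrow> dist b x \<le> 1; dist b q = 1\<rbrakk>
      \<Longrightarrow> b = a"
proof -
  define m where "m = real (card K)"
  have m: "0 < m"
    using K unit_simplex_finite by (auto simp: m_def card_gt_0_iff)
  define s where "s z = z - centroid K" for z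
  have inj: "inj_on s C"
    by (simp add: s_def inj_on_def)
  define D where "D = s ` C"
  have D: "finite D" "card D = 3"
    using C(1) card_image[OF inj] card_ge_0_finite[of C] by (auto simp: D_def)
  have "D \<subseteq> normal_space K"
    unfolding D_def s_def using equidistant_in_normal_space[OF K(1,3)] C(2) by auto
  moreover have "dim (normal_space K) = 2"
    using dim_normal_space[OF K(1,3)] K(2) by simp
  ultimately obtain v where v: "\<exists>z\<in>D. v z \<noteq> 0" "(\<Sum>z\<in>D. v z *\<^sub>R z) = 0"
    using exists_linear_relation[of D "normal_space K"] D by auto
  have norm_D: "x \<bullet> x = 1/2 + 1 / (2 * m)" if "x \<in> D" for x
    using that norm_minus_centroid_equidistant[OF K(1,3)] C(2)
    by (auto simp: D_def s_def m_def simp flip: power2_norm_eq_inner)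
  have inner_D: "0 < x \<bullet> y" "x \<noteq> y \<Longrightarrow> x \<bullet> y < 1/2 + 1 / (2 * m)" if "x \<in> D" "y \<in> D" for x y
  proof -
    have "dist x y \<le> 1"
      using that C(3) by (auto simp: D_def s_def dist_norm)
    then have "(dist x y)\<^sup>2 \<le> 1"
      by (simp add: power_le_one)
    moreover have "0 < 1 / (2 * m)"
      using m by simp
    ultimately show "0 < x \<bullet> y"
      unfolding dist_square_inner norm_D[OF that(1)] norm_D[OF that(2)] by linarith
    assume "x \<noteq> y"
    then have "0 < (dist x y)\<^sup>2" by simp
    then show "x \<bullet> y < 1/2 + 1 / (2 * m)"
      unfolding dist_square_inner norm_D[OF that(1)] norm_D[OF that(2)] by linarith
  qed
  have not_nonneg: False if w: "\<forall>z\<in>D. 0 \<le> w z" "\<exists>z\<in>D. w z \<noteq> 0" "(\<Sum>z\<in>D. w z *\<^sub>R z) = 0" for w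
  proof -
    obtain z where z: "z \<in> D" "0 < w z"
      using w by force
    have "0 < w z * (z \<bullet> z)"
      using z(2) inner_D(1)[OF z(1) z(1)] by simp
    also have "\<dots> \<le> (\<Sum>y\<in>D. w y * (y \<bullet> z))"
      using w(1) z D
      by (intro member_le_sum) (auto intro!: mult_nonneg_nonneg less_imp_le[OF inner_D(1)])
    also have "\<dots> = 0"
      using arg_cong[OF w(3), of "\<lambda>t. t \<bullet> z"] by (simp add: inner_sum_left)
    finally show False by simp
  qed
  have minus_v: "(\<Sum>z\<in>D. - v z *\<^sub>R z) = 0"
    using v(2) by (simp add: sum_negf)
  have "\<exists>z\<in>D. v z < 0" "\<exists>z\<in>D. 0 < v z"
    using not_nonneg[of v] not_nonneg[of "\<lambda>z. - v z"] v minus_v by (auto simp: not_less) (meson not_less)+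
  then obtain r where "one_negative D v r \<or> one_negative D (\<lambda>z. - v z) r"
    using three_point_signs[OF D(2)] by blast
  then obtain w where r: "one_negative D w r" and w: "(\<Sum>z\<in>D. w z *\<^sub>R z) = 0"
    using v(2) minus_v by blast
  have rD: "r \<in> D" "w r < 0" "\<And>z. z \<in> D - {r} \<Longrightarrow> 0 \<le> w z"
    using r by (auto simp: one_negative_def)
  have inner_r: "(\<Sum>z\<in>D - {r}. w z * (z \<bullet> y)) = - w r * (r \<bullet> y)" for y
  proof -
    have "w r * (r \<bullet> y) + (\<Sum>z\<in>D - {r}. w z * (z \<bullet> y)) = 0"
      using arg_cong[OF w, of "\<lambda>t. t \<bullet> y"]
      by (simp add: sum.remove[OF D(1) rD(1)] inner_add_left inner_sum_left)
    then show ?thesis by linarith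
  qed
  \<comment> \<open>The other points of the circle have smaller inner product with \<open>r\<close> than \<open>r\<close> itself.\<close>
  have sum_gt: "- w r < sum w (D - {r})"
  proof -
    have "\<exists>z\<in>D - {r}. 0 < w z"
    proof (rule ccontr)
      assume "\<not> ?thesis"
      then have "(\<Sum>z\<in>D - {r}. w z * (z \<bullet> r)) = 0"
        using rD(3) by (intro sum.neutral) force
      then show False
        using inner_r[of r] rD inner_D[of r r] by simp
    qed
    then obtain z where z: "z \<in> D - {r}" "0 < w z" by blast
    have lt: "x \<bullet> r < r \<bullet> r" if "x \<in> D - {r}" for x
      using inner_D(2)[of x r] norm_D[of r] rD(1) that by simp
    have "- w r * (r \<bullet> r) = (\<Sum>z\<in>D - {r}. w z * (z \<bullet> r))"
      using inner_r by simp
    also have "\<dots> < (\<Sum>z\<in>D - {r}. w z * (r \<bullet> r))"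
    proof (rule sum_strict_mono_ex1)
      show "\<forall>x\<in>D - {r}. w x * (x \<bullet> r) \<le> w x * (r \<bullet> r)"
        by (intro ballI mult_left_mono less_imp_le[OF lt] rD(3))
      show "\<exists>a\<in>D - {r}. w a * (a \<bullet> r) < w a * (r \<bullet> r)"
        using z lt by (intro bexI[of _ z]) auto
    qed (use D in auto)
    also have "\<dots> = sum w (D - {r}) * (r \<bullet> r)"
      by (simp add: sum_distrib_right)
    finally show ?thesis
      using mult_less_cancel_right_pos[OF inner_D(1)[OF rD(1) rD(1)]] by blast
  qed
  obtain q where q: "q \<in> C" "r = s q"
    using rD(1) by (auto simp: D_def)
  show ?thesis
  proof (rule that[OF q(1)])
    fix a b
    assume a: "a \<in> K" and b: "\<And>p. p \<in> K - {a} \<Longrightarrow> dist b p = 1"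
      "\<And>x. x \<in> C \<Longrightarrow> dist b x \<le> 1" "dist b q = 1"
    define k where "k = (dist b a)\<^sup>2 / (2 * m)"
    have "s b \<bullet> s b = 1/2 + 1 / (2 * m) + ((dist b a)\<^sup>2 - 1) / m"
      using norm_minus_centroid[OF K(1) a b(1)] by (simp add: s_def m_def power2_norm_eq_inner)
    then have inner_b: "2 * (s x \<bullet> s b) = 1 + 2 * k - (dist b x)\<^sup>2" if "x \<in> C" for x
    proof -
      have "dist (s b) (s x) = dist b x"
        by (simp add: s_def dist_norm)
      moreover have "s x \<bullet> s x = 1/2 + 1 / (2 * m)"
        using norm_D that by (simp add: D_def)
      moreover have "1/2 + 1 / (2 * m) + (1/2 + 1 / (2 * m) + ((dist b a)\<^sup>2 - 1) / m) = 1 + 2 * k"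
        by (simp add: k_def diff_divide_distrib)
      ultimately show ?thesis
        using dist_square_inner[of "s b" "s x"] \<open>s b \<bullet> s b = _\<close> by (simp add: inner_commute)
    qed
    show "b = a"
    proof (rule ccontr)
      assume "b \<noteq> a"
      then have "0 < k"
        using m by (simp add: k_def)
      have "sum w (D - {r}) * k \<le> (\<Sum>z\<in>D - {r}. w z * (z \<bullet> s b))"
        unfolding sum_distrib_right
      proof (intro sum_mono mult_left_mono)
        fix z assume z: "z \<in> D - {r}"
        then obtain x where "x \<in> C" "z = s x" by (auto simp: D_def)
        then show "k \<le> z \<bullet> s b"
          using inner_b[of x] power_le_one[of "dist b x" 2] b(2)[of x] by auto
      qed (use rD in auto)
      also have "\<dots> = - w r * k"
        using inner_r[of "s b"] inner_b[OF q(1)] b(3) q(2) by simp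
      finally show False
        using mult_strict_right_mono[OF sum_gt \<open>0 < k\<close>] by linarith
    qed
  qed
qed

section \<open>Counting\<close>

lemma unit_simplex_insert:
  assumes "unit_simplex K" "\<And>p. p \<in> K \<Longrightarrow> dist x p = 1"
  shows "unit_simplex (insert x K)"
  using assms by (auto simp: unit_simplex_def pairwise_insert dist_commute)

text \<open>
  The hypothesis says that among any three neighbours of a vertex one is a leaf. Edges at a leaf
  are at most as many as leaves. After deleting these, no vertex has three neighbours left, and so
  the remaining edges are at most as many as the remaining vertices.
\<close>

lemma card_edges_le_card_vertices:
  fixes Y :: "'a set" and E :: "'a set set"
  assumes Y: "finite Y" and E: "\<And>e. e \<in> E \<Longrightarrow> e \<subseteq> Y \<and> card e = 2"
    and leaf: "\<And>v C. \<lbrakk>card C = 3; \<And>u. u \<in> C \<Longrightarrow> {u, v} \<in> E\<rbrakk>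
      \<Longrightarrow> \<exists>q\<in>C. \<forall>b. {b, q} \<in> E \<longrightarrow> b = v"
  shows "card E \<le> card Y"
proof -
  define L where "L = {q \<in> Y. \<exists>v. \<forall>b. {b, q} \<in> E \<longrightarrow> b = v}"
  define E1 where "E1 = {e \<in> E. e \<inter> L \<noteq> {}}"
  define E2 where "E2 = {e \<in> E. e \<inter> L = {}}"
  have "finite E"
    using E Y by (intro finite_subset[of E "Pow Y"]) auto
  then have fin: "finite E" "finite L" "finite E2"
    using Y by (auto simp: L_def E2_def)
  have edge: "\<exists>b. e = {b, v} \<and> b \<noteq> v" if "e \<in> E" "v \<in> e" for e v
    using E[OF that(1)] that(2) by (auto simp: card_2_iff)
  have "\<forall>q\<in>L. \<exists>v. \<forall>b. {b, q} \<in> E \<longrightarrow> b = v"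
    by (simp add: L_def)
  from bchoice[OF this] obtain nb where nb: "\<And>q b. \<lbrakk>q \<in> L; {b, q} \<in> E\<rbrakk> \<Longrightarrow> b = nb q"
    by blast
  have "E1 \<subseteq> (\<lambda>q. {nb q, q}) ` L"
  proof
    fix e assume e: "e \<in> E1"
    then obtain q where q: "q \<in> e" "q \<in> L" and eE: "e \<in> E"
      by (auto simp: E1_def)
    obtain b where "e = {b, q}"
      using edge[OF eE q(1)] by blast
    then show "e \<in> (\<lambda>q. {nb q, q}) ` L"
      using nb[OF q(2)] eE q(2) by auto
  qed
  then have E1: "card E1 \<le> card L"
    using fin by (intro surj_card_le)
  have deg: "card {e \<in> E2. v \<in> e} \<le> 2" for v
  proof (rule ccontr)
    assume many: "\<not> ?thesis"
    define N where "N = {u. u \<notin> L \<and> {u, v} \<in> E}"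
    have "finite N"
      using E by (intro finite_subset[OF _ Y]) (auto simp: N_def)
    have "{e \<in> E2. v \<in> e} \<subseteq> (\<lambda>u. {u, v}) ` N"
    proof
      fix e assume e: "e \<in> {e \<in> E2. v \<in> e}"
      then obtain b where "e = {b, v}"
        using edge[of e v] by (auto simp: E2_def)
      then show "e \<in> (\<lambda>u. {u, v}) ` N"
        using e by (auto simp: E2_def N_def)
    qed
    then have "card {e \<in> E2. v \<in> e} \<le> card N"
      using \<open>finite N\<close> by (intro surj_card_le)
    then have "3 \<le> card N"
      using many by simp
    then obtain C where C: "C \<subseteq> N" "card C = 3"
      by (metis obtain_subset_with_card_n)
    then obtain q where q: "q \<in> C" "\<forall>b. {b, q} \<in> E \<longrightarrow> b = v"
      using leaf[of C v] by (auto simp: N_def)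
    then have "q \<in> L"
      using C E[of "{q, v}"] by (auto simp: L_def N_def)
    then show False
      using C q by (auto simp: N_def)
  qed
  have "\<forall>e\<in>E2. card {v \<in> Y - L. v \<in> e} = 2"
  proof
    fix e assume "e \<in> E2"
    then have "{v \<in> Y - L. v \<in> e} = e" "card e = 2"
      using E by (auto simp: E2_def)
    then show "card {v \<in> Y - L. v \<in> e} = 2" by simp
  qed
  then have "2 * card E2 = (\<Sum>v\<in>Y - L. card {e \<in> E2. v \<in> e})"
    using sum_multicount[of "Y - L" E2 "(\<in>)" 2] Y fin by simp
  also have "\<dots> \<le> (\<Sum>v\<in>Y - L. 2)"
    by (intro sum_mono deg)
  finally have "card E2 \<le> card (Y - L)"
    by simp
  moreover have "E = E1 \<union> E2"
    by (auto simp: E1_def E2_def)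
  then have "card E \<le> card E1 + card E2"
    by (simp add: card_Un_le)
  moreover have "card (Y - L) + card L = card Y"
    using Y by (subst card_Diff_subset) (auto simp: L_def card_mono)
  ultimately show ?thesis
    using E1 by linarith
qed

locale unit_diameter_set =
  fixes V :: "'a::euclidean_space set"
  assumes finite_V: "finite V" and near: "\<And>x y. \<lbrakk>x \<in> V; y \<in> V\<rbrakk> \<Longrightarrow> dist x y \<le> 1"
    and dim: "3 \<le> DIM('a)"
begin

definition facets :: "'a set set" where
  "facets = {K. K \<subseteq> V \<and> unit_simplex K \<and> card K = DIM('a)}"

lemma facetsD:
  assumes "K \<in> facets"
  shows "K \<subseteq> V" "unit_simplex K" "card K = DIM('a)" "finite K"
  using assms finite_V by (auto simp: facets_def intro: finite_subset)

lemma finite_facets: "finite facets"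
  using finite_V by (auto simp: facets_def intro: finite_subset[of _ "Pow V"])

lemma facets_share_not_codimension_three:
  assumes "K \<in> facets" "L \<in> facets"
  shows "card (K \<inter> L) \<noteq> DIM('a) - 3"
  using facetsD[OF assms(1)] facetsD[OF assms(2)] near dim
  by (intro simplices_share_not_codimension_three) auto

lemma facets_eq_if_union_not_adjacent:
  assumes K: "K \<in> facets" "K - Z = {x}" and L: "L \<in> facets" "L - Z = {x}"
    and Z: "finite Z" and card: "card (K \<inter> Z) = DIM('a) - 1" "card (L \<inter> Z) = DIM('a) - 1"
    and none: "\<And>T. \<lbrakk>T \<subseteq> Z; card T = DIM('a); \<And>p. p \<in> T \<Longrightarrow> dist x p = 1\<rbrakk> \<Longrightarrow> False"
  shows "K = L"
proof (rule ccontr)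
  assume "K \<noteq> L"
  have KL: "K = insert x (K \<inter> Z)" "L = insert x (L \<inter> Z)" "x \<notin> Z"
    using K(2) L(2) by auto
  have "K \<inter> Z \<noteq> L \<inter> Z"
    using KL \<open>K \<noteq> L\<close> by metis
  then have "\<not> L \<inter> Z \<subseteq> K \<inter> Z"
    using card Z by (metis card_subset_eq finite_Int)
  then obtain q where q: "q \<in> L \<inter> Z" "q \<notin> K \<inter> Z" by blast
  show False
  proof (rule none)
    show "insert q (K \<inter> Z) \<subseteq> Z" using q by auto
    show "card (insert q (K \<inter> Z)) = DIM('a)"
      using q Z card dim by simp
    fix p assume "p \<in> insert q (K \<inter> Z)"
    then show "dist x p = 1"
      using q KL unit_simplex_dist[OF facetsD(2)[OF K(1)], of x p]
        unit_simplex_dist[OF facetsD(2)[OF L(1)], of x p] by auto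
  qed
qed

text \<open>
  Each member of \<open>G\<close> has exactly one point outside \<open>Z\<close>, and no two have the same one: such a point
  would be adjacent to two different \<open>(d - 1)\<close>-subsets of \<open>Z\<close> and hence to \<open>d\<close> points of \<open>Z\<close>.
\<close>

lemma card_not_subset_le:
  assumes Z: "Z \<subseteq> V" and G: "G \<subseteq> facets"
    and card: "\<And>K. K \<in> G \<Longrightarrow> card (K \<inter> Z) = DIM('a) - 1"
    and none: "\<And>x T. \<lbrakk>x \<in> V - Z; T \<subseteq> Z; card T = DIM('a); \<And>p. p \<in> T \<Longrightarrow> dist x p = 1\<rbrakk> \<Longrightarrow> False"
  shows "card G \<le> card V - card Z"
proof -
  have fin: "finite Z"
    using Z finite_V finite_subset by blast
  have ex: "\<exists>x\<in>V - Z. K - Z = {x}" if "K \<in> G" for K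
  proof -
    have "K \<in> facets" using G that by blast
    then have "card (K - Z) = 1"
      using card[OF that] dim facetsD(3)[of K] card_Int_Diff[OF facetsD(4), of K Z] by simp
    then show ?thesis
      using facetsD(1)[OF \<open>K \<in> facets\<close>] by (auto simp: card_1_singleton_iff)
  qed
  have "inj_on (\<lambda>K. the_elem (K - Z)) G"
  proof (rule inj_onI)
    fix K L assume K: "K \<in> G" and L: "L \<in> G" and eq: "the_elem (K - Z) = the_elem (L - Z)"
    obtain x where x: "x \<in> V - Z" "K - Z = {x}" using ex[OF K] by blast
    moreover have "L - Z = {x}" using ex[OF L] eq x(2) by auto
    ultimately show "K = L"
      using facets_eq_if_union_not_adjacent[of K Z x L] K L G fin card none[of x] by blast
  qed
  moreover have "(\<lambda>K. the_elem (K - Z)) ` G \<subseteq> V - Z"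
    using ex by force
  ultimately have "card G \<le> card (V - Z)"
    using finite_V by (intro card_inj_on_le) auto
  then show ?thesis
    using Z fin by (simp add: card_Diff_subset)
qed

context
  assumes meet: "\<And>K L. \<lbrakk>K \<in> facets; L \<in> facets\<rbrakk> \<Longrightarrow> DIM('a) - 2 \<le> card (K \<inter> L)"
begin

text \<open>
  A clique not contained in \<open>Q\<close> meets every facet of \<open>Q\<close> in at least \<open>d - 2\<close> points, hence \<open>Q\<close>
  itself in \<open>d - 1\<close>. Its remaining point is private, because a point adjacent to \<open>d\<close> points of \<open>Q\<close>
  is the remaining vertex of \<open>Q\<close> by \<open>apex_unique\<close>. The \<open>d + 1\<close> facets of \<open>Q\<close> are paid for by the
  vertices of \<open>Q\<close>.
\<close>

lemma card_facets_le_if_full_simplex: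
  assumes Q: "Q \<subseteq> V" "unit_simplex Q" "card Q = DIM('a) + 1"
  shows "card facets \<le> card V"
proof -
  have finQ: "finite Q"
    using Q unit_simplex_finite by blast
  define G where "G = {K \<in> facets. \<not> K \<subseteq> Q}"
  have "card G \<le> card V - card Q"
  proof (rule card_not_subset_le[OF Q(1)])
    show "G \<subseteq> facets" by (auto simp: G_def)
  next
    fix K assume "K \<in> G"
    then have K: "K \<in> facets" "\<not> K \<subseteq> Q" by (auto simp: G_def)
    have "K \<inter> Q \<subset> K" using K by blast
    then have less: "card (K \<inter> Q) < DIM('a)"
      using facetsD[OF K(1)] psubset_card_mono[of K "K \<inter> Q"] by simp
    have minus: "DIM('a) - 2 \<le> card (K \<inter> (Q - {q}))" if "q \<in> Q" for q
      using that finQ Q unit_simplex_subset[OF Q(2), of "Q - {q}"]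
      by (intro meet K) (auto simp: facets_def)
    have "Q \<noteq> {}" using Q(3) by auto
    then obtain q0 where "q0 \<in> Q" by blast
    have "K \<inter> Q \<noteq> {}"
    proof
      assume "K \<inter> Q = {}"
      then have "K \<inter> (Q - {q0}) = {}" by blast
      then show False
        using minus[OF \<open>q0 \<in> Q\<close>] dim by simp
    qed
    then obtain q where q: "q \<in> K \<inter> Q" by blast
    have "K \<inter> (Q - {q}) = K \<inter> Q - {q}" by blast
    then have "DIM('a) - 2 \<le> card (K \<inter> Q) - 1"
      using minus[of q] q finQ by simp
    moreover have "0 < card (K \<inter> Q)"
      using q finQ by (auto simp: card_gt_0_iff)
    ultimately show "card (K \<inter> Q) = DIM('a) - 1"
      using less dim by linarith
  next
    fix x T
    assume x: "x \<in> V - Q" and T: "T \<subseteq> Q" "card T = DIM('a)" "\<And>p. p \<in> T \<Longrightarrow> dist x p = 1"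
    have "T \<noteq> Q" using T Q(3) by auto
    then obtain q where q: "q \<in> Q" "q \<notin> T" using T by blast
    have "x = q"
    proof (rule apex_unique)
      show "unit_simplex T" using Q(2) T(1) by (rule unit_simplex_subset)
      show "dist q p = 1" if "p \<in> T" for p
        using unit_simplex_dist[OF Q(2), of q p] q T(1) that by blast
      show "dist x q \<le> 1" using near x q Q(1) by blast
    qed (use T in auto)
    then show False using x q by blast
  qed
  moreover have "card {K \<in> facets. K \<subseteq> Q} \<le> card Q"
  proof -
    have "card {K \<in> facets. K \<subseteq> Q} \<le> card {K. K \<subseteq> Q \<and> card K = DIM('a)}"
      using finQ by (intro card_mono) (auto simp: facets_def)
    then show ?thesis
      using n_subsets[OF finQ, of "DIM('a)"] Q(3) by simp
  qed
  moreover have "facets = G \<union> {K \<in> facets. K \<subseteq> Q}"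
    by (auto simp: G_def)
  then have "card facets \<le> card G + card {K \<in> facets. K \<subseteq> Q}"
    by (metis card_Un_le)
  moreover have "card Q \<le> card V"
    using Q finite_V by (intro card_mono)
  ultimately show ?thesis by linarith
qed

lemma card_facets_le_if_star:
  assumes no_full: "\<And>Z x. \<lbrakk>Z \<in> facets; x \<in> V - Z\<rbrakk> \<Longrightarrow> \<exists>p\<in>Z. dist x p \<noteq> 1"
    and Z: "Z \<in> facets" "\<And>K. K \<in> facets \<Longrightarrow> DIM('a) - 1 \<le> card (K \<inter> Z)"
  shows "card facets \<le> card V"
proof -
  note Z' = facetsD[OF Z(1)]
  have "card (facets - {Z}) \<le> card V - card Z"
  proof (rule card_not_subset_le[OF Z'(1)])
    fix K assume "K \<in> facets - {Z}"
    then have K: "K \<in> facets" "K \<noteq> Z" by auto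
    then have "\<not> Z \<subseteq> K"
      using facetsD[of K] Z' card_subset_eq[of K Z] by auto
    then have "K \<inter> Z \<subset> Z" by blast
    then have "card (K \<inter> Z) < DIM('a)"
      using Z' psubset_card_mono[of Z "K \<inter> Z"] by simp
    then show "card (K \<inter> Z) = DIM('a) - 1"
      using Z(2)[OF K(1)] by linarith
  next
    fix x T
    assume "x \<in> V - Z" "T \<subseteq> Z" "card T = DIM('a)" "\<And>p. p \<in> T \<Longrightarrow> dist x p = 1"
    moreover from this have "T = Z"
      using Z' by (intro card_subset_eq) auto
    ultimately show False
      using no_full[OF Z(1), of x] by blast
  qed auto
  moreover have "card Z \<le> card V"
    using Z' finite_V by (intro card_mono)
  moreover have "card facets = Suc (card (facets - {Z}))"
    using finite_facets Z(1) by (rule card.remove)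
  ultimately show ?thesis
    using Z' dim by linarith
qed

text \<open>
  Let \<open>W\<close> be the intersection of \<open>A\<close> and \<open>B\<close>. Since \<open>C\<close> misses a point of \<open>W\<close>, it contains some \<open>a\<close> in
  \<open>A - B\<close> and some \<open>b\<close> in \<open>B - A\<close>, so \<open>Z = W \<union> {a, b}\<close> is a clique. It is the centre of a star: the
  cliques \<open>A\<close>, \<open>B\<close>, \<open>C\<close> arise from \<open>Z\<close> by exchanging the three different points \<open>b\<close>, \<open>a\<close>, \<open>w\<close>. A
  clique \<open>K\<close> that misses two points of \<open>Z\<close> keeps one of these three, and then its intersection with
  \<open>A\<close>, \<open>B\<close> or \<open>C\<close> is large only if a point outside \<open>Z\<close> is adjacent to all of \<open>Z\<close>, contrary to \<open>no_full\<close>.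
\<close>

lemma card_facets_le_if_no_common_ridge:
  assumes no_full: "\<And>Z x. \<lbrakk>Z \<in> facets; x \<in> V - Z\<rbrakk> \<Longrightarrow> \<exists>p\<in>Z. dist x p \<noteq> 1"
    and A: "A \<in> facets" and B: "B \<in> facets" and C: "C \<in> facets"
    and AB: "card (A \<inter> B) = DIM('a) - 2" and not_common: "\<not> A \<inter> B \<subseteq> C"
  shows "card facets \<le> card V"
proof -
  define W where "W = A \<inter> B"
  note A' = facetsD[OF A] and B' = facetsD[OF B] and C' = facetsD[OF C]
  have finW: "finite W" and cardW: "card W = DIM('a) - 2"
    using A' AB by (auto simp: W_def)
  obtain w where w: "w \<in> W" "w \<notin> C"
    using not_common by (auto simp: W_def)
  have not_sub: "\<not> K \<inter> L \<subseteq> W - {w}" if "K \<in> facets" "L \<in> facets" for K L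
  proof
    assume "K \<inter> L \<subseteq> W - {w}"
    then have "card (K \<inter> L) \<le> card (W - {w})"
      using finW by (intro card_mono) auto
    then show False
      using meet[OF that] w finW cardW dim by simp
  qed
  obtain a where a: "a \<in> C" "a \<in> A" "a \<notin> B"
    using not_sub[OF C A] w by (auto simp: W_def)
  obtain b where b: "b \<in> C" "b \<in> B" "b \<notin> A"
    using not_sub[OF C B] w by (auto simp: W_def)
  have other: "\<exists>a'. A' - W = {a, a'}" if "finite A'" "card A' = DIM('a)" "W \<subseteq> A'" "a \<in> A' - W" for A' a
  proof -
    have "card (A' - W - {a}) = 1"
      using that finW cardW dim by (simp add: card_Diff_subset)
    then obtain a' where "A' - W - {a} = {a'}"
      by (auto simp: card_1_singleton_iff)
    then show ?thesis using that by (intro exI[of _ a']) auto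
  qed
  obtain a' where a': "A - W = {a, a'}"
    using other[of A a] A' a by (auto simp: W_def)
  obtain b' where b': "B - W = {b, b'}"
    using other[of B b] B' b by (auto simp: W_def)
  define Z where "Z = insert a (insert b W)"
  have dist_A: "\<And>p q. \<lbrakk>p \<in> A; q \<in> A; p \<noteq> q\<rbrakk> \<Longrightarrow> dist p q = 1"
    and dist_B: "\<And>p q. \<lbrakk>p \<in> B; q \<in> B; p \<noteq> q\<rbrakk> \<Longrightarrow> dist p q = 1"
    and dist_C: "\<And>p q. \<lbrakk>p \<in> C; q \<in> C; p \<noteq> q\<rbrakk> \<Longrightarrow> dist p q = 1"
    using unit_simplex_dist A'(2) B'(2) C'(2) by blast+
  have "a \<noteq> b" "a \<notin> W" "b \<notin> W" using a b by (auto simp: W_def)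
  have Z: "Z \<in> facets"
  proof -
    have "unit_simplex W"
      using A'(2) by (rule unit_simplex_subset) (auto simp: W_def)
    then have "unit_simplex (insert b W)"
      by (rule unit_simplex_insert) (use dist_B b \<open>b \<notin> W\<close> in \<open>force simp: W_def\<close>)
    then have "unit_simplex Z"
      unfolding Z_def
    proof (rule unit_simplex_insert)
      fix p assume "p \<in> insert b W"
      then show "dist a p = 1"
        using dist_A[of a p] dist_C[of a p] a b by (auto simp: W_def)
    qed
    moreover have "card Z = DIM('a)"
      using \<open>a \<noteq> b\<close> \<open>a \<notin> W\<close> \<open>b \<notin> W\<close> finW cardW dim by (simp add: Z_def)
    moreover have "Z \<subseteq> V"
      using a b A'(1) B'(1) by (auto simp: Z_def W_def)
    ultimately show ?thesis by (simp add: facets_def)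
  qed
  have "a' \<in> A" "a' \<notin> W" "b' \<in> B" "b' \<notin> W"
    using a' b' by auto
  have a'_Z: "a' \<in> V - Z"
  proof -
    have "a' \<noteq> a"
    proof
      assume "a' = a"
      then have "card (A - W) = 1" using a' by simp
      then show False
        using A' finW cardW dim card_Diff_subset[of W A] by (auto simp: W_def)
    qed
    then show ?thesis
      using \<open>a' \<in> A\<close> \<open>a' \<notin> W\<close> A'(1) b by (auto simp: Z_def)
  qed
  have b'_Z: "b' \<in> V - Z"
  proof -
    have "b' \<noteq> b"
    proof
      assume "b' = b"
      then have "card (B - W) = 1" using b' by simp
      then show False
        using B' finW cardW dim card_Diff_subset[of W B] by (auto simp: W_def)
    qed
    then show ?thesis
      using \<open>b' \<in> B\<close> \<open>b' \<notin> W\<close> B'(1) a by (auto simp: Z_def)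
  qed
  have not_a'b: "\<not> (a' \<in> K \<and> b \<in> K)" if "K \<in> facets" for K
  proof
    assume "a' \<in> K \<and> b \<in> K"
    then have "dist a' b = 1"
      using unit_simplex_dist[OF facetsD(2)[OF that]] a'_Z by (auto simp: Z_def)
    then have "\<forall>p\<in>Z. dist a' p = 1"
      using dist_A[OF \<open>a' \<in> A\<close>] a a'_Z by (auto simp: Z_def W_def)
    then show False
      using no_full[OF Z a'_Z] by blast
  qed
  have not_b'a: "\<not> (b' \<in> K \<and> a \<in> K)" if "K \<in> facets" for K
  proof
    assume "b' \<in> K \<and> a \<in> K"
    then have "dist b' a = 1"
      using unit_simplex_dist[OF facetsD(2)[OF that]] b'_Z by (auto simp: Z_def)
    then have "\<forall>p\<in>Z. dist b' p = 1"
      using dist_B[OF \<open>b' \<in> B\<close>] b b'_Z by (auto simp: Z_def W_def)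
    then show False
      using no_full[OF Z b'_Z] by blast
  qed
  have "Z - {w} \<subseteq> C"
  proof -
    have "C \<inter> A \<subseteq> insert a (C \<inter> W)"
      using a' not_a'b[OF C] b by blast
    then have "card (C \<inter> A) \<le> card (insert a (C \<inter> W))"
      using finW by (intro card_mono) auto
    also have "\<dots> \<le> Suc (card (C \<inter> W))"
      by (rule card_insert_le_m1) auto
    finally have "card (W - {w}) \<le> card (C \<inter> W)"
      using meet[OF C A] w finW cardW by simp
    then have "C \<inter> W = W - {w}"
      using w finW by (intro card_seteq) auto
    then show ?thesis
      using a b by (auto simp: Z_def)
  qed
  show ?thesis
  proof (rule card_facets_le_if_star[OF no_full Z])
    fix K assume K: "K \<in> facets"
    show "DIM('a) - 1 \<le> card (K \<inter> Z)"
    proof (rule ccontr)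
      assume small: "\<not> ?thesis"
      have finKZ: "finite (K \<inter> Z)"
        using facetsD(4)[OF K] by blast
      have "b \<notin> K"
      proof
        assume "b \<in> K"
        then have "K \<inter> A \<subseteq> K \<inter> Z - {b}"
          using a' not_a'b[OF K] b by (auto simp: Z_def)
        then have "card (K \<inter> A) \<le> card (K \<inter> Z - {b})"
          using finKZ by (intro card_mono) auto
        moreover have "b \<in> K \<inter> Z" using \<open>b \<in> K\<close> by (simp add: Z_def)
        ultimately show False
          using meet[OF K A] small finKZ dim by simp
      qed
      moreover have "a \<notin> K"
      proof
        assume "a \<in> K"
        then have "K \<inter> B \<subseteq> K \<inter> Z - {a}"
          using b' not_b'a[OF K] a by (auto simp: Z_def)
        then have "card (K \<inter> B) \<le> card (K \<inter> Z - {a})"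
          using finKZ by (intro card_mono) auto
        moreover have "a \<in> K \<inter> Z" using \<open>a \<in> K\<close> by (simp add: Z_def)
        ultimately show False
          using meet[OF K B] small finKZ dim by simp
      qed
      ultimately have "K \<inter> Z \<subseteq> W"
        by (auto simp: Z_def)
      then have "K \<inter> Z = W"
        using meet[OF K Z] finW cardW by (intro card_seteq) auto
      then have "W \<subseteq> K" by blast
      obtain c where c: "c \<in> K" "c \<in> C" "c \<notin> W - {w}"
        using not_sub[OF K C] by blast
      then have "c \<notin> Z"
        using \<open>K \<inter> Z = W\<close> w by blast
      have "\<forall>p\<in>Z. dist c p = 1"
      proof
        fix p assume "p \<in> Z"
        then have "p \<in> K \<or> p \<in> C" "c \<noteq> p"
          using \<open>Z - {w} \<subseteq> C\<close> \<open>W \<subseteq> K\<close> w \<open>c \<notin> Z\<close> by auto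
        then show "dist c p = 1"
          using c dist_C[of c p] unit_simplex_dist[OF facetsD(2)[OF K], of c p] by auto
      qed
      then show False
        using no_full[OF Z, of c] c(1) \<open>c \<notin> Z\<close> facetsD(1)[OF K] by blast
    qed
  qed
qed

text \<open>
  Removing \<open>W\<close> turns the cliques into the edges of a graph. A vertex \<open>v\<close> of this graph and \<open>W\<close> form
  a simplex of \<open>d - 1\<close> points, to which \<open>middle_point_has_one_neighbour\<close> applies.
\<close>

lemma card_facets_le_if_common_ridge:
  assumes W: "card W = DIM('a) - 2" "\<And>K. K \<in> facets \<Longrightarrow> W \<subseteq> K"
  shows "card facets \<le> card V"
proof -
  have finW: "finite W"
    using W(1) dim by (intro card_ge_0_finite) simp
  define E where "E = (\<lambda>K. K - W) ` facets"
  have E_facet: "e \<union> W \<in> facets \<and> e \<inter> W = {}" if "e \<in> E" for e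
    using that W(2) by (auto simp: E_def Un_absorb2)
  have "inj_on (\<lambda>K. K - W) facets"
    using W(2) by (intro inj_onI) blast
  then have "card facets = card E"
    by (simp add: E_def card_image)
  also have "\<dots> \<le> card (V - W)"
  proof (rule card_edges_le_card_vertices)
    show "finite (V - W)" using finite_V by simp
    show "e \<subseteq> V - W \<and> card e = 2" if e: "e \<in> E" for e
    proof -
      obtain K where K: "K \<in> facets" "e = K - W"
        using e by (auto simp: E_def)
      then show ?thesis
        using W facetsD[OF K(1)] finW dim by (auto simp: card_Diff_subset)
    qed
    fix v C
    assume C: "card C = 3" "\<And>u. u \<in> C \<Longrightarrow> {u, v} \<in> E"
    have dist: "dist p q = 1" if "{x, y} \<in> E" "p \<in> {x, y} \<union> W" "q \<in> {x, y} \<union> W" "p \<noteq> q" for x y p q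
      using E_facet[OF that(1)] that facetsD(2) unit_simplex_dist by blast
    have inV: "x \<in> V" if "{x, y} \<in> E" for x y
      using E_facet[OF that] facetsD(1) by blast
    have "C \<noteq> {}" using C(1) by auto
    then obtain u where u: "{u, v} \<in> E" using C(2) by blast
    define K where "K = insert v W"
    have K: "unit_simplex K" "card K + 1 = DIM('a)" "K \<noteq> {}" "v \<in> K"
    proof -
      have "v \<notin> W" using E_facet[OF u] by blast
      then show "card K + 1 = DIM('a)"
        using finW W(1) dim by (simp add: K_def)
      show "unit_simplex K"
        using facetsD(2)[of "{u, v} \<union> W"] E_facet[OF u] by (auto simp: K_def elim: unit_simplex_subset)
    qed (auto simp: K_def)
    have neq: "x \<noteq> y \<and> x \<notin> W" if xy: "{x, y} \<in> E" for x y
    proof -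
      obtain L where L: "L \<in> facets" "{x, y} = L - W"
        using xy by (auto simp: E_def)
      then have "card {x, y} = 2"
        using W facetsD[OF L(1)] finW dim by (auto simp: card_Diff_subset)
      then have "x \<noteq> y" by auto
      then show ?thesis using L(2) by auto
    qed
    obtain q where q: "q \<in> C" and q_leaf: "\<And>a b. \<lbrakk>a \<in> K; \<And>p. p \<in> K - {a} \<Longrightarrow> dist b p = 1;
        \<And>x. x \<in> C \<Longrightarrow> dist b x \<le> 1; dist b q = 1\<rbrakk> \<Longrightarrow> b = a"
    proof (rule middle_point_has_one_neighbour[OF K(1-3) C(1)])
      show "dist x p = 1" if "x \<in> C" "p \<in> K" for x p
        using dist[OF C(2)[OF that(1)], of x p] neq[OF C(2)[OF that(1)]] that(2)
        by (auto simp: K_def)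
      show "dist x y \<le> 1" if "x \<in> C" "y \<in> C" for x y
        using that C(2) inV near by blast
    qed blast
    show "\<exists>q\<in>C. \<forall>b. {b, q} \<in> E \<longrightarrow> b = v"
    proof (intro bexI[OF _ q] allI impI)
      fix b assume b: "{b, q} \<in> E"
      show "b = v"
      proof (rule q_leaf[OF K(4)])
        show "dist b p = 1" if "p \<in> K - {v}" for p
          using that dist[OF b, of b p] neq[OF b] by (auto simp: K_def)
        show "dist b x \<le> 1" if "x \<in> C" for x
          using that C(2) inV b near by blast
        show "dist b q = 1"
          using dist[OF b, of b q] neq[OF b] by auto
      qed
    qed
  qed
  also have "\<dots> \<le> card V"
    using finite_V by (intro card_mono) auto
  finally show ?thesis .
qed

lemma card_facets_le: "card facets \<le> card V"
proof (cases "\<exists>Q. Q \<subseteq> V \<and> unit_simplex Q \<and> card Q = DIM('a) + 1")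
  case True
  then show ?thesis using card_facets_le_if_full_simplex by blast
next
  case False
  have no_full: "\<exists>p\<in>Z. dist x p \<noteq> 1" if Z: "Z \<in> facets" and x: "x \<in> V - Z" for Z x
  proof (rule ccontr)
    assume "\<not> ?thesis"
    then have "unit_simplex (insert x Z)"
      using facetsD(2)[OF Z] by (intro unit_simplex_insert) auto
    moreover have "card (insert x Z) = DIM('a) + 1" "insert x Z \<subseteq> V"
      using facetsD[OF Z] x by auto
    ultimately show False using False by blast
  qed
  show ?thesis
  proof (cases "\<exists>A\<in>facets. \<exists>B\<in>facets. card (A \<inter> B) = DIM('a) - 2")
    case True
    then obtain A B where AB: "A \<in> facets" "B \<in> facets" "card (A \<inter> B) = DIM('a) - 2" by blast
    show ?thesis
    proof (cases "\<forall>C\<in>facets. A \<inter> B \<subseteq> C")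
      case True
      then show ?thesis using card_facets_le_if_common_ridge[OF AB(3)] by blast
    next
      case False
      then show ?thesis using card_facets_le_if_no_common_ridge[OF no_full AB(1,2) _ AB(3)] by blast
    qed
  next
    case pairs: False
    show ?thesis
    proof (cases "facets = {}")
      case False
      then obtain Z where Z: "Z \<in> facets" by blast
      have "DIM('a) - 1 \<le> card (K \<inter> Z)" if "K \<in> facets" for K
      proof -
        have "card (K \<inter> Z) \<noteq> DIM('a) - 2" using pairs that Z by blast
        then show ?thesis using meet[OF that Z] by linarith
      qed
      then show ?thesis using card_facets_le_if_star[OF no_full Z] by blast
    qed simp
  qed
qed

end

end

section \<open>Diameter graphs\<close>

lemma mem_cliques_diameter_graph:
  assumes "diameter_graph V E"
  shows "K \<in> cliques_of_size k V E \<longleftrightarrow>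
    K \<subseteq> V \<and> card K = k \<and> (\<forall>x\<in>K. \<forall>y\<in>K. x \<noteq> y \<longrightarrow> dist x y = diameter V)"
proof -
  have fin: "finite V" and E: "{x, y} \<in> E \<longleftrightarrow> x \<in> V \<and> y \<in> V \<and> x \<noteq> y \<and> dist x y = diameter V" for x y
    using assms by (auto simp: diameter_graph_def doubleton_eq_iff dist_commute)
  then show ?thesis
    using finite_subset[OF _ fin, of K] by (auto simp: cliques_of_size_def clique_def)
qed

lemma facets_rescaled:
  fixes V :: "'a::euclidean_space set"
  assumes graph: "diameter_graph V E" and pos: "0 < diameter V" and dim: "3 \<le> DIM('a)"
  defines "s \<equiv> \<lambda>x. (1 / diameter V) *\<^sub>R x"
  shows "unit_diameter_set (s ` V)"
    and "unit_diameter_set.facets (s ` V) = image s ` cliques_of_size DIM('a) V E"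
proof -
  have fin: "finite V"
    using graph by (simp add: diameter_graph_def)
  have dist_s: "dist (s x) (s y) = dist x y / diameter V" for x y
    using pos by (simp add: s_def dist_norm flip: scaleR_diff_right)
  have inj: "inj_on s A" for A
    using pos by (simp add: s_def inj_on_def)
  show "unit_diameter_set (s ` V)"
  proof
    show "dist x y \<le> 1" if "x \<in> s ` V" "y \<in> s ` V" for x y
      using that diameter_bounded_bound[OF finite_imp_bounded[OF fin]] pos by (auto simp: dist_s)
  qed (use fin dim in auto)
  then interpret unit_diameter_set "s ` V" .
  have simplex: "unit_simplex (s ` K) \<longleftrightarrow> (\<forall>x\<in>K. \<forall>y\<in>K. x \<noteq> y \<longrightarrow> dist x y = diameter V)"
    if "K \<subseteq> V" for K
  proof -
    have "s x = s y \<longleftrightarrow> x = y" and "dist (s x) (s y) = 1 \<longleftrightarrow> dist x y = diameter V" for x y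
      using pos unfolding dist_s by (auto simp: s_def)
    then show ?thesis
      using finite_subset[OF that fin] by (simp add: unit_simplex_def pairwise_def)
  qed
  show "facets = image s ` cliques_of_size DIM('a) V E"
  proof (intro subset_antisym subsetI)
    fix L assume "L \<in> facets"
    then have L: "L \<subseteq> s ` V" "unit_simplex L" "card L = DIM('a)"
      by (auto simp: facets_def)
    then obtain K where K: "K \<subseteq> V" "L = s ` K"
      by (auto simp: subset_image_iff)
    then have "K \<in> cliques_of_size DIM('a) V E"
      using L simplex[OF K(1)] card_image[OF inj] by (simp add: mem_cliques_diameter_graph[OF graph])
    then show "L \<in> image s ` cliques_of_size DIM('a) V E"
      using K by blast
  next
    fix L assume "L \<in> image s ` cliques_of_size DIM('a) V E"
    then obtain K where K: "L = s ` K" "K \<subseteq> V" "card K = DIM('a)"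
      "\<forall>x\<in>K. \<forall>y\<in>K. x \<noteq> y \<longrightarrow> dist x y = diameter V"
      by (auto simp: mem_cliques_diameter_graph[OF graph])
    then show "L \<in> facets"
      using simplex[OF K(2)] card_image[OF inj] by (auto simp: facets_def)
  qed
qed

theorem theorem6:
  fixes V :: "(real ^ 'd) set" and E :: "(real ^ 'd) set set" and d :: nat
  assumes "d = CARD('d)" and "d \<ge> 3"
    and "diameter_graph V E"
  shows "(\<forall>K \<in> cliques_of_size d V E. \<forall>L \<in> cliques_of_size d V E. card (K \<inter> L) \<noteq> d - 3) \<and>
         ((\<forall>K \<in> cliques_of_size d V E. \<forall>L \<in> cliques_of_size d V E. card (K \<inter> L) \<ge> d - 3) \<longrightarrow>
           card (cliques_of_size d V E) \<le> card V)"
proof -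
  note mem = mem_cliques_diameter_graph[OF assms(3)]
  have d: "d = DIM(real ^ 'd)"
    using assms(1) by simp
  show ?thesis
  proof (cases "0 < diameter V")
    case False
    have "cliques_of_size d V E = {}"
    proof (rule equals0I)
      fix K assume K: "K \<in> cliques_of_size d V E"
      then have "2 \<le> card K"
        using assms(2) by (simp add: mem)
      then obtain x y where "x \<in> K" "y \<in> K" "x \<noteq> y"
        by (meson card_2_iff' obtain_subset_with_card_n subset_iff)
      then have "dist x y = diameter V"
        using K by (simp add: mem)
      moreover have "0 < dist x y"
        using \<open>x \<noteq> y\<close> by simp
      ultimately show False
        using False by linarith
    qed
    then show ?thesis by simp
  next
    case True
    define s :: "real ^ 'd \<Rightarrow> real ^ 'd" where "s = (\<lambda>x. (1 / diameter V) *\<^sub>R x)"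
    interpret unit_diameter_set "s ` V"
      unfolding s_def using facets_rescaled(1)[OF assms(3) True] assms(2) d by simp
    have facets: "facets = image s ` cliques_of_size d V E"
      unfolding s_def d using facets_rescaled(2)[OF assms(3) True] assms(2) d by simp
    have inj: "inj_on s A" for A
      using True by (simp add: s_def inj_on_def)
    have card_Int: "card (s ` K \<inter> s ` L) = card (K \<inter> L)" for K L
      using card_image[OF inj] image_Int[OF inj[of UNIV], of K L] by metis
    have not_three: "card (K \<inter> L) \<noteq> d - 3"
      if "K \<in> cliques_of_size d V E" "L \<in> cliques_of_size d V E" for K L
      using facets_share_not_codimension_three[of "s ` K" "s ` L"] that
      by (simp add: facets card_Int d)
    have "card (cliques_of_size d V E) \<le> card V"
      if share: "\<forall>K \<in> cliques_of_size d V E. \<forall>L \<in> cliques_of_size d V E. card (K \<inter> L) \<ge> d - 3"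
    proof -
      have "card facets \<le> card (s ` V)"
      proof (rule card_facets_le)
        fix K' L' assume "K' \<in> facets" "L' \<in> facets"
        then obtain K L where KL: "K \<in> cliques_of_size d V E" "L \<in> cliques_of_size d V E"
          "K' = s ` K" "L' = s ` L"
          by (auto simp: facets)
        have "d - 3 \<le> card (K \<inter> L)" "card (K \<inter> L) \<noteq> d - 3"
          using share not_three KL by auto
        then show "DIM(real ^ 'd) - 2 \<le> card (K' \<inter> L')"
          unfolding KL card_Int d[symmetric] by linarith
      qed
      moreover have "card facets = card (cliques_of_size d V E)"
        unfolding facets using inj[of UNIV] by (intro card_image inj_on_image) (auto intro: inj_on_subset)
      ultimately show ?thesis
        using card_image[OF inj] by simp
    qed
    then show ?thesis
      using not_three by blast
  qed
qed

end
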